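(* Let $u$ be the solution of the parabolic problem $\partial_t u+\mathcal{L}u=f$ in $\Omega\times(0,T]$, $u(\cdot,0)=u^0$, $u=0$ on $\partial\Omega\times[0,T]$, and let the Green's function bounds (with constants $\kappa_0,\kappa_1,\kappa_1',\gamma$) stated in the context hold. Let $0=t_0<t_1<\dots<t_M=T$ be an arbitrary mesh and let $U^j\in H_0^1(\Omega)$ be the backward Euler approximations: $U^0=u^0$ and $$\delta_t U^j+\mathcal{L}U^j=f^j\quad\text{in }\Omega,\qquad j=1,\dots,M.$$ Then $$\|u(T)-U^M\|_{\infty,\Omega}\le\sum_{j=1}^M \mathrm{e}^{-\gamma(T-t_j)}\left(\eta_{\bar f}^j+\eta_{\min}^j\right),\qquad \eta_{\min}^j:=\min\left\{\eta_{\delta U}^j,\eta_{\delta\mathcal{L}U}^j\right\},$$ where $$\eta_{\bar f}^j:=\kappa_0\int_{I_j}\|f(s)-f^j\|_{\infty,\Omega}\,\mathrm{d}s,\qquad \eta_{\delta\mathcal{L}U}^j:=\frac{\kappa_0\tau_j^2}{2}\|\delta_t(\mathcal{L}U)^j\|_{\infty,\Omega},\qquad \eta_{\delta U}^j:=\rho_j\|\delta_tU^j\|_{\infty,\Omega},$$ $$\rho_j:=\kappa_1\left[\tau_j-(T-t_j)\ln\left(1+\frac{\tau_j}{T-t_j}\right)\right]+\kappa_1'\frac{\tau_j^2}{2}.$$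
   Context: Setting. $\Omega\subset\mathbb{R}^n$ is a spatial domain with Lipschitz boundary, $T>0$, $\mathcal{L}$ is a second-order linear elliptic operator in $\Omega$ with adjoint $\mathcal{L}^*$, $f\colon[0,T]\to L_2(\Omega)$, and $\mathcal{K}w:=\partial_t w+\mathcal{L}w$. For functions $w$ on $\Omega\times[0,T]$ write $w(t):=w(\cdot,t)$. $\|\cdot\|_{p,\Omega}$, $p\in[1,\infty]$, is the norm of $L_p(\Omega)$, and $\langle\cdot,\cdot\rangle$ denotes both the duality pairing on $H^{-1}(\Omega)\times H_0^1(\Omega)$ and the $L_2(\Omega)$ scalar product. Green's function. For fixed $x\in\Omega$, $\mathcal{G}$ solves $\partial_t\mathcal{G}+\mathcal{L}^*\mathcal{G}=0$ in $\Omega\times\mathbb{R}^+$, $\mathcal{G}|_{\partial\Omega}=0$, $\mathcal{G}(0)=\delta_x$ (Dirac distribution at $x$). For all $w\in W^{1,1}([0,T],H_0^1(\Omega))$ and $t\in(0,T]$ one has $w(x,t)=\langle\mathcal{G}(t),w(0)\rangle+\int_0^t\langle\mathcal{G}(t-s),(\mathcal{K}w)(s)\rangle\,\mathrm{d}s$; the solution $u$ is assumed regular enough that this representation applies to $u$ minus a continuous function that is piecewise polynomial in time and built from the discrete approximations. Standing assumption. There are non-negative constants $\kappa_0,\kappa_1,\kappa_2,\kappa_1',\kappa_2',\gamma$ such that, with $\kappa_0'=0$, $\|\partial_t^p\mathcal{G}(t)\|_{1,\Omega}\le\left(\frac{\kappa_p}{t^p}+\kappa_p'\right)\mathrm{e}^{-\gamma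 t}$ for all $x\in\bar\Omega$, $t\in[0,T]$, $p=0,1,2$. Mesh notation. $I_j:=(t_{j-1},t_j)$, $\tau_j:=t_j-t_{j-1}$; $f^j:=f(t_j)$; $\delta_t v^j:=(v^j-v^{j-1})/\tau_j$; $(\mathcal{L}U)^j:=\mathcal{L}U^j$. In the definition of $\rho_j$, for $j=M$ (where $T-t_M=0$) the product $(T-t_j)\ln(1+\tau_j/(T-t_j))$ is read as its limit $0$. *)

theory Defs
  imports "HOL-Analysis.Analysis" "HOL-Probability.Essential_Supremum"
begin

type_synonym 'n fn = "real^'n \<Rightarrow> real"

text \<open>
  Elements of function spaces over \<open>\<Omega>\<close> are represented by functions on the whole space, of which
  only the values almost everywhere in \<open>\<Omega>\<close> matter. Norms that may be infinite, such as the
  \<open>L\<^sub>\<infinity>\<close> norm of an arbitrary element of \<open>L\<^sub>2\<close>, take values in \<^typ>\<open>ennreal\<close>.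
\<close>

section \<open>Domains\<close>

text \<open>
  Near each boundary point, \<open>\<Omega>\<close> is the region below the graph of a Lipschitz function \<open>\<psi>\<close> over the
  hyperplane orthogonal to some unit vector \<open>e\<close>; \<open>x - (x \<bullet> e) *\<^sub>R e\<close> is the projection of \<open>x\<close>.
\<close>

definition lipschitz_boundary :: "(real^'n) set \<Rightarrow> bool" where
  "lipschitz_boundary \<Omega> \<longleftrightarrow>
     (\<forall>p\<in>frontier \<Omega>. \<exists>U e \<psi> C. open U \<and> p \<in> U \<and> norm e = 1 \<and>
        C-lipschitz_on {y. y \<bullet> e = 0} \<psi> \<and>
        \<Omega> \<inter> U = {x\<in>U. x \<bullet> e < (\<psi> (x - (x \<bullet> e) *\<^sub>R e) :: real)})"

definition lipschitz_domain :: "(real^'n) set \<Rightarrow> bool" where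
  "lipschitz_domain \<Omega> \<longleftrightarrow> open \<Omega> \<and> connected \<Omega> \<and> \<Omega> \<noteq> {} \<and> lipschitz_boundary \<Omega>"

section \<open>Lebesgue spaces\<close>

definition L1 :: "(real^'n) set \<Rightarrow> 'n fn set" where
  "L1 \<Omega> = {w. integrable (lebesgue_on \<Omega>) w}"

definition L2 :: "(real^'n) set \<Rightarrow> 'n fn set" where
  "L2 \<Omega> = {w. w \<in> borel_measurable (lebesgue_on \<Omega>) \<and>
              integrable (lebesgue_on \<Omega>) (\<lambda>x. (w x)\<^sup>2)}"

definition L1_norm :: "(real^'n) set \<Rightarrow> 'n fn \<Rightarrow> ennreal" where
  "L1_norm \<Omega> w = (\<integral>\<^sup>+x. ennreal \<bar>w x\<bar> \<partial>lebesgue_on \<Omega>)"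

definition Linf_norm :: "(real^'n) set \<Rightarrow> 'n fn \<Rightarrow> ennreal" where
  "Linf_norm \<Omega> w = esssup (lebesgue_on \<Omega>) (\<lambda>x. ennreal \<bar>w x\<bar>)"

definition Linf :: "(real^'n) set \<Rightarrow> 'n fn set" where
  "Linf \<Omega> = {w. w \<in> borel_measurable (lebesgue_on \<Omega>) \<and> Linf_norm \<Omega> w < \<infinity>}"

definition pairing :: "(real^'n) set \<Rightarrow> 'n fn \<Rightarrow> 'n fn \<Rightarrow> real" where
  "pairing \<Omega> w v = (LINT x|lebesgue_on \<Omega>. w x * v x)"

section \<open>Sobolev spaces\<close>

definition partial_deriv :: "'n::finite \<Rightarrow> 'n fn \<Rightarrow> 'n fn" where
  "partial_deriv i \<phi> = (\<lambda>x. frechet_derivative \<phi> (at x) (axis i 1))"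

primrec Ck :: "nat \<Rightarrow> 'n::finite fn \<Rightarrow> bool" where
  "Ck 0 \<phi> = continuous_on UNIV \<phi>"
| "Ck (Suc k) \<phi> = ((\<forall>x. \<phi> differentiable at x) \<and> (\<forall>i. Ck k (partial_deriv i \<phi>)))"

definition test_functions :: "(real^'n) set \<Rightarrow> 'n fn set" where
  "test_functions \<Omega> = {\<phi>. (\<forall>k. Ck k \<phi>) \<and> compact (closure {x. \<phi> x \<noteq> 0}) \<and>
                          closure {x. \<phi> x \<noteq> 0} \<subseteq> \<Omega>}"

definition is_weak_grad :: "(real^'n) set \<Rightarrow> 'n fn \<Rightarrow> (real^'n \<Rightarrow> real^'n) \<Rightarrow> bool" where
  "is_weak_grad \<Omega> w g \<longleftrightarrow> (\<forall>i. (\<lambda>x. g x $ i) \<in> L2 \<Omega>) \<and>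
     (\<forall>\<phi>\<in>test_functions \<Omega>. \<forall>i.
        pairing \<Omega> w (partial_deriv i \<phi>) = - pairing \<Omega> (\<lambda>x. g x $ i) \<phi>)"

definition weak_grad :: "(real^'n) set \<Rightarrow> 'n fn \<Rightarrow> real^'n \<Rightarrow> real^'n" where
  "weak_grad \<Omega> w = (SOME g. is_weak_grad \<Omega> w g)"

definition H1 :: "(real^'n) set \<Rightarrow> 'n fn set" where
  "H1 \<Omega> = {w\<in>L2 \<Omega>. \<exists>g. is_weak_grad \<Omega> w g}"

definition H1_norm :: "(real^'n) set \<Rightarrow> 'n fn \<Rightarrow> real" where
  "H1_norm \<Omega> w = sqrt (LINT x|lebesgue_on \<Omega>. (w x)\<^sup>2 + (norm (weak_grad \<Omega> w x))\<^sup>2)"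

definition H10 :: "(real^'n) set \<Rightarrow> 'n fn set" where
  "H10 \<Omega> = {w\<in>H1 \<Omega>. \<exists>\<phi>. (\<forall>k. \<phi> k \<in> test_functions \<Omega>) \<and>
                  (\<lambda>k. H1_norm \<Omega> (\<lambda>x. w x - \<phi> k x)) \<longlonglongrightarrow> 0}"

text \<open>
  Elements of \<open>H\<^sup>-\<^sup>1(\<Omega>)\<close> are functionals \<open>F\<close>, of which only the values on \<open>H\<^sub>0\<^sup>1(\<Omega>)\<close> matter; the
  duality pairing with \<open>v\<close> is \<open>F v\<close>, and \<open>w \<in> L\<^sub>2(\<Omega>)\<close> is identified with \<open>pairing \<Omega> w\<close>.
  The \<open>L\<^sub>\<infinity>\<close> norm of \<open>F\<close> is that of the function \<open>g \<in> L\<^sub>\<infinity>(\<Omega>)\<close> which acts as \<open>F\<close> does, and is infinite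
  if there is none. (The pairing of \<open>g\<close> with \<open>v\<close> is an absolutely convergent integral for
  \<open>v \<in> L\<^sub>1(\<Omega>)\<close>, which is no restriction when \<open>\<Omega>\<close> is bounded.)
\<close>

definition Linf_norm_functional :: "(real^'n) set \<Rightarrow> ('n fn \<Rightarrow> real) \<Rightarrow> ennreal" where
  "Linf_norm_functional \<Omega> F =
     (INF g\<in>{g\<in>Linf \<Omega>. \<forall>v\<in>H10 \<Omega> \<inter> L1 \<Omega>. F v = pairing \<Omega> g v}. Linf_norm \<Omega> g)"

section \<open>Elliptic operators\<close>

text \<open>
  Weak form of \<open>\<L>w = - div (A \<nabla>w + w b) + c \<bullet> \<nabla>w + d w\<close>, bounded from \<open>H\<^sub>0\<^sup>1(\<Omega>)\<close> to \<open>H\<^sup>-\<^sup>1(\<Omega>)\<close>, where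
  \<open>L w v\<close> stands for \<open>\<langle>\<L>w, v\<rangle>\<close>. Bounded measurable coefficients and uniform ellipticity are a
  special case.
\<close>

definition second_order_elliptic :: "(real^'n) set \<Rightarrow> ('n fn \<Rightarrow> 'n fn \<Rightarrow> real) \<Rightarrow> bool" where
  "second_order_elliptic \<Omega> L \<longleftrightarrow>
     (\<exists>(A :: real^'n \<Rightarrow> real^'n^'n) (b :: real^'n \<Rightarrow> real^'n) (c :: real^'n \<Rightarrow> real^'n)
        (d :: real^'n \<Rightarrow> real) C.
        A \<in> borel_measurable (lebesgue_on \<Omega>) \<and> b \<in> borel_measurable (lebesgue_on \<Omega>) \<and>
        c \<in> borel_measurable (lebesgue_on \<Omega>) \<and> d \<in> borel_measurable (lebesgue_on \<Omega>) \<and>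
        (AE x in lebesgue_on \<Omega>. \<forall>\<xi>. \<xi> \<noteq> 0 \<longrightarrow> \<xi> \<bullet> (A x *v \<xi>) > 0) \<and>
        (\<forall>w\<in>H10 \<Omega>. \<forall>v\<in>H10 \<Omega>.
           let a = (\<lambda>x. (A x *v weak_grad \<Omega> w x + w x *\<^sub>R b x) \<bullet> weak_grad \<Omega> v x
                        + (c x \<bullet> weak_grad \<Omega> w x + d x * w x) * v x)
           in integrable (lebesgue_on \<Omega>) a \<and> L w v = integral\<^sup>L (lebesgue_on \<Omega>) a \<and>
              \<bar>L w v\<bar> \<le> C * H1_norm \<Omega> w * H1_norm \<Omega> v))"

definition adjoint_op :: "('n::finite fn \<Rightarrow> 'n fn \<Rightarrow> real) \<Rightarrow> 'n fn \<Rightarrow> 'n fn \<Rightarrow> real" where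
  "adjoint_op L v = (\<lambda>w. L w v)"

section \<open>Functions of time with values in \<open>H\<^sub>0\<^sup>1(\<Omega>)\<close>\<close>

text \<open>
  A list of pairs \<open>(S, y)\<close> encodes the simple function \<open>s \<mapsto> \<Sum> 1\<^sub>S(s) y\<close>. The Bochner integral is
  defined through approximation by simple functions, as \<^const>\<open>has_bochner_integral\<close> is; the
  latter needs the range to be a type, which \<open>H\<^sub>0\<^sup>1(\<Omega>)\<close> is not.
\<close>

definition simple_H10 :: "(real^'n) set \<Rightarrow> (real set \<times> 'n fn) list \<Rightarrow> bool" where
  "simple_H10 \<Omega> \<sigma> \<longleftrightarrow> (\<forall>(S, y)\<in>set \<sigma>. S \<in> sets borel \<and> y \<in> H10 \<Omega>)"

definition simple_eval :: "(real set \<times> 'n::finite fn) list \<Rightarrow> real \<Rightarrow> 'n fn" where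
  "simple_eval \<sigma> s = (\<lambda>x. \<Sum>(S, y)\<leftarrow>\<sigma>. indicat_real S s * y x)"

definition simple_integral_on :: "real \<Rightarrow> real \<Rightarrow> (real set \<times> 'n::finite fn) list \<Rightarrow> 'n fn" where
  "simple_integral_on a b \<sigma> = (\<lambda>x. \<Sum>(S, y)\<leftarrow>\<sigma>. measure lborel (S \<inter> {a..b}) * y x)"

definition has_bochner_integral_H10 ::
    "(real^'n) set \<Rightarrow> real \<Rightarrow> real \<Rightarrow> (real \<Rightarrow> 'n fn) \<Rightarrow> 'n fn \<Rightarrow> bool" where
  "has_bochner_integral_H10 \<Omega> a b F I \<longleftrightarrow>
     I \<in> H10 \<Omega> \<and> (AE s in lebesgue_on {a..b}. F s \<in> H10 \<Omega>) \<and>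
     (\<exists>\<sigma>. (\<forall>k. simple_H10 \<Omega> (\<sigma> k)) \<and>
        (\<forall>k. (\<lambda>s. H1_norm \<Omega> (\<lambda>x. F s x - simple_eval (\<sigma> k) s x))
               \<in> borel_measurable (lebesgue_on {a..b})) \<and>
        (\<lambda>k. \<integral>\<^sup>+s. ennreal (H1_norm \<Omega> (\<lambda>x. F s x - simple_eval (\<sigma> k) s x))
               \<partial>lebesgue_on {a..b}) \<longlonglongrightarrow> 0 \<and>
        (\<lambda>k. H1_norm \<Omega> (\<lambda>x. I x - simple_integral_on a b (\<sigma> k) x)) \<longlonglongrightarrow> 0)"

text \<open>
  \<open>w \<in> W\<^sup>1\<^sup>,\<^sup>1([0,T], H\<^sub>0\<^sup>1(\<Omega>))\<close> with derivative \<open>w'\<close>. Point values in time refer to the continuous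
  representative, which is the primitive of its Bochner integrable derivative.
\<close>

definition W11_H10 :: "(real^'n) set \<Rightarrow> real \<Rightarrow> (real \<Rightarrow> 'n fn) \<Rightarrow> (real \<Rightarrow> 'n fn) \<Rightarrow> bool" where
  "W11_H10 \<Omega> T w w' \<longleftrightarrow>
     (\<forall>t\<in>{0..T}. w t \<in> H10 \<Omega> \<and> has_bochner_integral_H10 \<Omega> 0 t w' (\<lambda>x. w t x - w 0 x))"

section \<open>The parabolic problem and its Green's function\<close>

text \<open>\<open>(\<K>w)(s) = \<partial>\<^sub>t w(s) + \<L>w(s)\<close> as an element of \<open>H\<^sup>-\<^sup>1(\<Omega>)\<close>, where \<open>w'\<close> is the time derivative.\<close>

definition parabolic_op :: "(real^'n) set \<Rightarrow> ('n fn \<Rightarrow> 'n fn \<Rightarrow> real) \<Rightarrow>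
    (real \<Rightarrow> 'n fn) \<Rightarrow> (real \<Rightarrow> 'n fn) \<Rightarrow> real \<Rightarrow> 'n fn \<Rightarrow> real" where
  "parabolic_op \<Omega> L w w' s = (\<lambda>v. pairing \<Omega> (w' s) v + L (w s) v)"

definition parabolic_solution :: "(real^'n) set \<Rightarrow> real \<Rightarrow> ('n fn \<Rightarrow> 'n fn \<Rightarrow> real) \<Rightarrow>
    (real \<Rightarrow> 'n fn) \<Rightarrow> 'n fn \<Rightarrow> (real \<Rightarrow> 'n fn) \<Rightarrow> bool" where
  "parabolic_solution \<Omega> T L f u0 u \<longleftrightarrow>
     (\<exists>u'. W11_H10 \<Omega> T u u' \<and>
        (AE s in lebesgue_on {0..T}. \<forall>v\<in>H10 \<Omega>.
           parabolic_op \<Omega> L u u' s v = pairing \<Omega> (f s) v)) \<and>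
     (AE x in lebesgue_on \<Omega>. u 0 x = u0 x)"

text \<open>\<open>g t\<close> is the Green's function \<open>\<G>(t)\<close> for the fixed point \<open>x\<close>.\<close>

definition greens_function :: "(real^'n) set \<Rightarrow> ('n fn \<Rightarrow> 'n fn \<Rightarrow> real) \<Rightarrow>
    real^'n \<Rightarrow> (real \<Rightarrow> 'n fn) \<Rightarrow> bool" where
  "greens_function \<Omega> L x g \<longleftrightarrow>
     (\<forall>t>0. g t \<in> H10 \<Omega> \<inter> L1 \<Omega> \<and>
        (\<forall>v\<in>H10 \<Omega>. ((\<lambda>s. pairing \<Omega> (g s) v) has_real_derivative - adjoint_op L (g t) v) (at t))) \<and>
     (\<forall>\<phi>\<in>test_functions \<Omega>. ((\<lambda>t. pairing \<Omega> (g t) \<phi>) \<longlongrightarrow> \<phi> x) (at_right 0))"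

text \<open>
  \<open>D p t\<close> is \<open>\<partial>\<^sub>t\<^sup>p g(t)\<close> for \<open>p \<le> 2\<close>, with the derivatives in the weak sense of
  \<open>H\<^sup>-\<^sup>1(\<Omega>)\<close>; \<open>h \<in> L\<^sub>1(\<Omega>)\<close> is identified with the functional \<open>pairing \<Omega> h\<close> on \<open>H\<^sub>0\<^sup>1(\<Omega>) \<inter> L\<^sub>\<infinity>(\<Omega>)\<close>.
\<close>

definition time_derivatives :: "(real^'n) set \<Rightarrow> (real \<Rightarrow> 'n fn) \<Rightarrow> (nat \<Rightarrow> real \<Rightarrow> 'n fn) \<Rightarrow> bool" where
  "time_derivatives \<Omega> g D \<longleftrightarrow>
     D 0 = g \<and> (\<forall>p\<le>2. \<forall>t>0. D p t \<in> L1 \<Omega>) \<and>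
     (\<forall>p<2. \<forall>t>0. \<forall>v\<in>H10 \<Omega> \<inter> Linf \<Omega>.
        ((\<lambda>s. pairing \<Omega> (D p s) v) has_real_derivative pairing \<Omega> (D (Suc p) t) v) (at t))"

text \<open>
  As \<open>w t\<close> is determined only up to null sets, the representation formula is required for almost
  all \<open>x\<close>.
\<close>

definition greens_representation :: "(real^'n) set \<Rightarrow> real \<Rightarrow> ('n fn \<Rightarrow> 'n fn \<Rightarrow> real) \<Rightarrow>
    (real^'n \<Rightarrow> real \<Rightarrow> 'n fn) \<Rightarrow> bool" where
  "greens_representation \<Omega> T L G \<longleftrightarrow>
     (\<forall>w w'. W11_H10 \<Omega> T w w' \<longrightarrow> (\<forall>t\<in>{0<..T}. AE x in lebesgue_on \<Omega>.
        integrable (lebesgue_on {0<..<t}) (\<lambda>s. parabolic_op \<Omega> L w w' s (G x (t - s))) \<and>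
        w t x = pairing \<Omega> (G x t) (w 0) +
          (LINT s|lebesgue_on {0<..<t}. parabolic_op \<Omega> L w w' s (G x (t - s)))))"

section \<open>Backward Euler approximations and error indicators\<close>

definition mesh :: "real \<Rightarrow> nat \<Rightarrow> (nat \<Rightarrow> real) \<Rightarrow> bool" where
  "mesh T M t \<longleftrightarrow> t 0 = 0 \<and> t M = T \<and> (\<forall>j<M. t j < t (Suc j))"

definition tau :: "(nat \<Rightarrow> real) \<Rightarrow> nat \<Rightarrow> real" where
  "tau t j = t j - t (j - 1)"

definition diff_quot :: "(nat \<Rightarrow> real) \<Rightarrow> (nat \<Rightarrow> 'a \<Rightarrow> real) \<Rightarrow> nat \<Rightarrow> 'a \<Rightarrow> real" where
  "diff_quot t V j = (\<lambda>x. (V j x - V (j - 1) x) / tau t j)"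

definition backward_euler :: "(real^'n) set \<Rightarrow> ('n fn \<Rightarrow> 'n fn \<Rightarrow> real) \<Rightarrow> (real \<Rightarrow> 'n fn) \<Rightarrow>
    'n fn \<Rightarrow> nat \<Rightarrow> (nat \<Rightarrow> real) \<Rightarrow> (nat \<Rightarrow> 'n fn) \<Rightarrow> bool" where
  "backward_euler \<Omega> L f u0 M t U \<longleftrightarrow>
     (\<forall>j\<le>M. U j \<in> H10 \<Omega>) \<and> (AE x in lebesgue_on \<Omega>. U 0 x = u0 x) \<and>
     (\<forall>j\<in>{1..M}. \<forall>v\<in>H10 \<Omega>.
        pairing \<Omega> (diff_quot t U j) v + L (U j) v = pairing \<Omega> (f (t j)) v)"

definition eta_f :: "(real^'n) set \<Rightarrow> real \<Rightarrow> (real \<Rightarrow> 'n fn) \<Rightarrow> (nat \<Rightarrow> real) \<Rightarrow> nat \<Rightarrow> ennreal" where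
  "eta_f \<Omega> \<kappa>0 f t j = ennreal \<kappa>0 *
     (\<integral>\<^sup>+s. Linf_norm \<Omega> (\<lambda>x. f s x - f (t j) x) \<partial>lebesgue_on {t (j - 1)<..<t j})"

definition eta_dLU :: "(real^'n) set \<Rightarrow> real \<Rightarrow> ('n fn \<Rightarrow> 'n fn \<Rightarrow> real) \<Rightarrow> (nat \<Rightarrow> real) \<Rightarrow>
    (nat \<Rightarrow> 'n fn) \<Rightarrow> nat \<Rightarrow> ennreal" where
  "eta_dLU \<Omega> \<kappa>0 L t U j = ennreal (\<kappa>0 * (tau t j)\<^sup>2 / 2) *
     Linf_norm_functional \<Omega> (diff_quot t (\<lambda>i. L (U i)) j)"

text \<open>
  For \<open>t j = T\<close> the term \<open>(T - t j) * ln \<dots>\<close> has its limit value \<open>0\<close>, since its first factor is \<open>0\<close>.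
\<close>

definition rho :: "real \<Rightarrow> real \<Rightarrow> real \<Rightarrow> (nat \<Rightarrow> real) \<Rightarrow> nat \<Rightarrow> real" where
  "rho T \<kappa>1 \<kappa>1' t j =
     \<kappa>1 * (tau t j - (T - t j) * ln (1 + tau t j / (T - t j))) + \<kappa>1' * (tau t j)\<^sup>2 / 2"

definition eta_dU :: "(real^'n) set \<Rightarrow> real \<Rightarrow> real \<Rightarrow> real \<Rightarrow> (nat \<Rightarrow> real) \<Rightarrow>
    (nat \<Rightarrow> 'n fn) \<Rightarrow> nat \<Rightarrow> ennreal" where
  "eta_dU \<Omega> T \<kappa>1 \<kappa>1' t U j = ennreal (rho T \<kappa>1 \<kappa>1' t j) * Linf_norm \<Omega> (diff_quot t U j)"

definition eta_min :: "(real^'n) set \<Rightarrow> real \<Rightarrow> real \<Rightarrow> real \<Rightarrow> real \<Rightarrow>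
    ('n fn \<Rightarrow> 'n fn \<Rightarrow> real) \<Rightarrow> (nat \<Rightarrow> real) \<Rightarrow> (nat \<Rightarrow> 'n fn) \<Rightarrow> nat \<Rightarrow> ennreal" where
  "eta_min \<Omega> T \<kappa>0 \<kappa>1 \<kappa>1' L t U j = min (eta_dU \<Omega> T \<kappa>1 \<kappa>1' t U j) (eta_dLU \<Omega> \<kappa>0 L t U j)"

end

theory Submission
  imports Defs "HOL-Real_Asymp.Real_Asymp"
begin

text \<open>
  Let \<open>\<delta>\<^sub>j = (U\<^sub>j - U\<^sub>j\<^sub>-\<^sub>1) / \<tau>\<^sub>j\<close> and let \<open>V\<close> be the continuous, piecewise linear interpolant of the values
  \<open>U\<^sub>j\<close>, so that \<open>V(s) = U\<^sub>j - (t\<^sub>j - s) \<delta>\<^sub>j\<close> on the \<open>j\<close>-th cell. Subtracting the backward Euler equation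
  from the parabolic one gives the residual of \<open>w = u - V\<close> on that cell,
  \<open>\<K>w(s) = (f(s) - f(t\<^sub>j)) + (t\<^sub>j - s) \<L>\<delta>\<^sub>j\<close>.
  Since \<open>w(0) = 0\<close> and \<open>w(T) = u(T) - U\<^sub>M\<close>, the representation formula expresses the error at almost every
  \<open>x\<close> as the integral over time of \<open>\<langle>\<K>w(s), \<G>(T - s)\<rangle>\<close>, and it remains to bound each cell.

  The data term is bounded by \<open>\<parallel>\<G>\<parallel>\<^sub>1 \<le> \<kappa>\<^sub>0 e\<^sup>-\<^sup>\<gamma>\<^sup>r\<close>. The other term can be bounded in two ways: if
  \<open>\<L>\<delta>\<^sub>j\<close> is a bounded function, the same bound on \<open>\<G>\<close> and the weight \<open>t\<^sub>j - s\<close> give \<open>\<kappa>\<^sub>0 \<tau>\<^sub>j\<^sup>2 / 2\<close>;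
  alternatively, \<open>\<langle>\<L>\<delta>\<^sub>j, \<G>\<rangle> = - \<langle>\<delta>\<^sub>j, \<partial>\<^sub>t\<G>\<rangle>\<close> moves the operator onto the Green's function, and the weight
  tames the singularity \<open>\<kappa>\<^sub>1 / (T - s)\<close> of \<open>\<partial>\<^sub>t\<G>\<close>, which integrates to \<open>\<rho>\<^sub>j\<close>. These are the lemmas
  \<open>op_le_functional_bound\<close>, \<open>op_le_time_derivative_bound\<close> and \<open>cell_residual_estimate\<close>.

  Three points need more than this computation. To apply the representation formula, \<open>w\<close> must lie in
  \<open>W\<^sup>1\<^sup>,\<^sup>1(H\<^sub>0\<^sup>1)\<close>, so \<open>H\<^sub>0\<^sup>1\<close> must be a linear space. Its norm refers to some chosen weak gradient, hence
  linearity rests on the uniqueness of weak gradients (the fundamental lemma of the calculus of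
  variations, for which smooth bumps are constructed) and on the fact that test functions have weak
  gradients (integration by parts). Second, nothing guarantees that \<open>s \<mapsto> \<parallel>f(s) - f(t\<^sub>j)\<parallel>\<^sub>\<infinity>\<close> is measurable; its
  integral is a lower integral, which still dominates the integral of every measurable minorant.
  Third, the error indicators may read \<open>0 \<cdot> \<infinity> = 0\<close>, so vanishing constants must make the term itself vanish:
  \<open>\<kappa>\<^sub>0 = 0\<close> forces \<open>\<G> = 0\<close>, and \<open>\<kappa>\<^sub>1 = \<kappa>\<^sub>1' = 0\<close> forces \<open>\<G>\<close> to be stationary.
\<close>

section \<open>Smooth bumps on boxes\<close>

text \<open>
  With the factors \<open>1 / y\<^sup>m\<close> included, these flat functions are closed under differentiation up to linear
  combinations, which makes smoothness a matter of bookkeeping.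
\<close>

definition flat_exp :: "real \<Rightarrow> nat \<Rightarrow> real \<Rightarrow> real" where
  "flat_exp c m y = (if y > 0 then exp (- c / y) / y ^ m else 0)"

text \<open>
  Only \<open>y = 0\<close> needs an argument: there the difference quotient is again a flat function with exponent \<open>m + 1\<close>,
  and the exponential beats every power.
\<close>

lemma flat_exp_deriv:
  assumes "c > 0"
  shows "(flat_exp c m has_real_derivative c * flat_exp c (m + 2) y - m * flat_exp c (m + 1) y) (at y)"
proof -
  consider "y > 0" | "y < 0" | "y = 0" by linarith
  then show ?thesis
  proof cases
    case 1
    have "((\<lambda>y. inverse y ^ m) has_real_derivative - real m * inverse y ^ (m + 1)) (at y)"
    proof (cases m)
      case (Suc l)
      show ?thesis unfolding Suc
        by (rule DERIV_power_Suc[OF DERIV_inverse, THEN DERIV_cong]) (use 1 in \<open>auto simp: algebra_simps\<close>)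
    qed simp
    from _ this have "((\<lambda>y. exp (- c * inverse y) * inverse y ^ m) has_real_derivative
        exp (- c * inverse y) * (c * inverse y ^ 2) * inverse y ^ m
          + - real m * inverse y ^ (m + 1) * exp (- c * inverse y)) (at y)"
      by (rule DERIV_mult) (use 1 in \<open>auto intro!: derivative_eq_intros simp: power2_eq_square\<close>)
    then have "((\<lambda>y. exp (- c * inverse y) * inverse y ^ m) has_real_derivative
        c * flat_exp c (m + 2) y - m * flat_exp c (m + 1) y) (at y)"
      using 1 by (simp add: flat_exp_def divide_inverse power_inverse algebra_simps power2_eq_square)
    then show ?thesis
    proof (rule has_field_derivative_transform_within_open[where S = "{0<..}"])
    qed (use 1 in \<open>auto simp: flat_exp_def divide_inverse power_inverse\<close>)
  next
    case 2
    have "((\<lambda>y. 0) has_real_derivative 0) (at y)" by simp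
    then have "(flat_exp c m has_real_derivative 0) (at y)"
      by (rule has_field_derivative_transform_within_open[where S = "{..<0}"])
         (use 2 in \<open>auto simp: flat_exp_def\<close>)
    then show ?thesis using 2 by (simp add: flat_exp_def)
  next
    case 3
    have R: "((\<lambda>h. exp (- c / h) / h ^ (m + 1)) \<longlongrightarrow> 0) (at_right 0)"
      using assms by real_asymp
    have "((\<lambda>h. flat_exp c m h / h) \<longlongrightarrow> 0) (at_right 0)"
      by (rule Lim_transform_eventually[OF R])
         (auto simp: flat_exp_def eventually_at_right_field intro!: exI[of _ 1])
    moreover have "((\<lambda>h. flat_exp c m h / h) \<longlongrightarrow> 0) (at_left 0)"
      by (rule tendsto_eventually) (auto simp: flat_exp_def eventually_at_left_field intro!: exI[of _ "-1"])
    ultimately have "((\<lambda>h. flat_exp c m h / h) \<longlongrightarrow> 0) (at 0)"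
      by (simp add: filterlim_at_split)
    then show ?thesis using 3 by (simp add: DERIV_def flat_exp_def)
  qed
qed

lemma partial_deriv_eqI:
  assumes "(\<phi> has_derivative \<phi>') (at x)"
  shows "partial_deriv i \<phi> x = \<phi>' (axis i 1)"
  using frechet_derivative_at[OF assms] by (simp add: partial_deriv_def)

text \<open>
  A class of functions that is closed under partial derivatives and consists of differentiable functions
  contains only smooth functions. This is the smallest such class with the bumps in it.
\<close>

inductive flat_algebra :: "real \<Rightarrow> 'n::finite fn \<Rightarrow> bool" for c where
  const: "flat_algebra c (\<lambda>x. a)"
| flat: "flat_algebra c (\<lambda>x. flat_exp c m (s * x $ i + a))"
| add: "flat_algebra c v \<Longrightarrow> flat_algebra c w \<Longrightarrow> flat_algebra c (\<lambda>x. v x + w x)"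
| mult: "flat_algebra c v \<Longrightarrow> flat_algebra c w \<Longrightarrow> flat_algebra c (\<lambda>x. v x * w x)"

lemma flat_algebra_partial_deriv:
  fixes \<phi> :: "'n::finite fn"
  assumes "flat_algebra c \<phi>" and "c > 0"
  shows "(\<forall>x. \<phi> differentiable at x) \<and> (\<forall>i. flat_algebra c (partial_deriv i \<phi>))"
  using assms(1)
proof induction
  case (const a)
  have "partial_deriv i (\<lambda>x. a) = (\<lambda>x. 0)" for i :: 'n
    by (rule ext, subst partial_deriv_eqI[OF has_derivative_const]) simp
  then show ?case by (simp add: flat_algebra.const)
next
  case (flat m s j a)
  let ?d = "\<lambda>x. c * flat_exp c (m + 2) (s * x $ j + a) - m * flat_exp c (m + 1) (s * x $ j + a)"
  have D: "((\<lambda>x. flat_exp c m (s * x $ j + a)) has_derivative (\<lambda>h. s * h $ j * ?d x)) (at x)" for x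
  proof -
    have "((\<lambda>x. s * x $ j + a) has_derivative (\<lambda>h. s * h $ j)) (at x)"
      by (auto intro!: derivative_eq_intros bounded_linear.has_derivative[OF bounded_linear_vec_nth])
    from has_derivative_compose[OF this flat_exp_deriv[OF assms(2), unfolded has_field_derivative_def]]
    show ?thesis by (simp add: mult.commute)
  qed
  have "partial_deriv i (\<lambda>x. flat_exp c m (s * x $ j + a)) =
      (\<lambda>x. s * axis i 1 $ j * c * flat_exp c (m + 2) (s * x $ j + a)
         + (- m * s * axis i 1 $ j) * flat_exp c (m + 1) (s * x $ j + a))" for i
    by (rule ext, subst partial_deriv_eqI[OF D]) (simp add: algebra_simps)
  moreover have "flat_algebra c (\<lambda>x. s * axis i 1 $ j * c * flat_exp c (m + 2) (s * x $ j + a)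
         + (- m * s * axis i 1 $ j) * flat_exp c (m + 1) (s * x $ j + a))" for i
    by (intro flat_algebra.intros)
  ultimately have "flat_algebra c (partial_deriv i (\<lambda>x. flat_exp c m (s * x $ j + a)))" for i
    by (simp only:)
  then show ?case using D by (auto simp only: differentiable_def)
next
  case (add v w)
  have "partial_deriv i (\<lambda>x. v x + w x) = (\<lambda>x. partial_deriv i v x + partial_deriv i w x)" for i
  proof
    fix x
    have "(v has_derivative frechet_derivative v (at x)) (at x)"
         "(w has_derivative frechet_derivative w (at x)) (at x)"
      using add.IH by (auto simp: frechet_derivative_works)
    from partial_deriv_eqI[OF has_derivative_add[OF this]]
    show "partial_deriv i (\<lambda>x. v x + w x) x = partial_deriv i v x + partial_deriv i w x"
      by (simp add: partial_deriv_def)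
  qed
  then show ?case using add by (auto intro: flat_algebra.intros)
next
  case (mult v w)
  have "partial_deriv i (\<lambda>x. v x * w x) = (\<lambda>x. v x * partial_deriv i w x + partial_deriv i v x * w x)" for i
  proof
    fix x
    have "(v has_derivative frechet_derivative v (at x)) (at x)"
         "(w has_derivative frechet_derivative w (at x)) (at x)"
      using mult.IH by (auto simp: frechet_derivative_works)
    from partial_deriv_eqI[OF has_derivative_mult[OF this]]
    show "partial_deriv i (\<lambda>x. v x * w x) x = v x * partial_deriv i w x + partial_deriv i v x * w x"
      by (simp add: partial_deriv_def)
  qed
  then show ?case
    using mult by (auto intro!: flat_algebra.add flat_algebra.mult)
qed

lemma flat_algebra_Ck:
  assumes "c > 0"
  shows "flat_algebra c \<phi> \<Longrightarrow> Ck k \<phi>"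
proof (induction k arbitrary: \<phi>)
  case 0
  then show ?case
    using flat_algebra_partial_deriv[OF 0 assms]
    by (auto intro!: differentiable_imp_continuous_on simp: differentiable_on_def)
next
  case (Suc k)
  then show ?case using flat_algebra_partial_deriv[OF Suc.prems assms] by auto
qed

text \<open>
  As \<open>c\<close> tends to 0, these bumps increase to the indicator of the open box, so functions orthogonal to
  all test functions are orthogonal to indicators of boxes.
\<close>

definition box_bump :: "real \<Rightarrow> real^'n::finite \<Rightarrow> real^'n \<Rightarrow> 'n fn" where
  "box_bump c a b = (\<lambda>x. \<Prod>i\<in>UNIV. flat_exp c 0 (x $ i - a $ i) * flat_exp c 0 (b $ i - x $ i))"

lemma box_bump_algebra: "flat_algebra c (box_bump c a b)"
proof -
  have "flat_algebra c (\<lambda>x. \<Prod>i\<in>I. flat_exp c 0 (x $ i - a $ i) * flat_exp c 0 (b $ i - x $ i))"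
    if "finite I" for I
    using that
  proof induction
    case (insert j I)
    have "flat_algebra c (\<lambda>x. flat_exp c 0 (1 * x $ j + (- a $ j)) * flat_exp c 0 ((-1) * x $ j + b $ j))"
      by (intro flat_algebra.intros)
    then show ?case using insert by (auto simp: intro!: flat_algebra.mult)
  qed (auto intro: flat_algebra.const)
  then show ?thesis by (simp add: box_bump_def)
qed

lemma box_bump_nonzero_iff: "box_bump c a b x \<noteq> 0 \<longleftrightarrow> x \<in> box a b"
  by (auto simp: box_bump_def flat_exp_def mem_box_cart)

lemma box_bump_in_test_functions:
  assumes "c > 0" and "cbox a b \<subseteq> \<Omega>"
  shows "box_bump c a b \<in> test_functions \<Omega>"
proof -
  have *: "{x. box_bump c a b x \<noteq> 0} = box a b"
    using box_bump_nonzero_iff by auto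
  have "closure (box a b) \<subseteq> cbox a b"
    by (intro closure_minimal box_subset_cbox closed_cbox)
  moreover have "bounded (box a b)" by simp
  ultimately show ?thesis
    using assms flat_algebra_Ck[OF assms(1) box_bump_algebra]
    by (auto simp: test_functions_def * compact_closure)
qed

lemma box_bump_bound: "c > 0 \<Longrightarrow> \<bar>box_bump c a b x\<bar> \<le> indicat_real (box a b) x"
proof -
  assume c: "c > 0"
  have "\<bar>box_bump c a b x\<bar> \<le> 1"
    unfolding box_bump_def abs_prod
    by (rule prod_le_1) (use c in \<open>auto simp: flat_exp_def abs_mult intro!: mult_le_one\<close>)
  then show ?thesis using box_bump_nonzero_iff[of c a b x] by (auto simp: indicator_def)
qed

lemma box_bump_tendsto: "(\<lambda>k. box_bump (1 / real (Suc k)) a b x) \<longlonglongrightarrow> indicat_real (box a b) x"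
proof (cases "x \<in> box a b")
  case True
  have "(\<lambda>k. flat_exp (1 / real (Suc k)) 0 y) \<longlonglongrightarrow> 1" if "y > 0" for y
    using that unfolding flat_exp_def by simp real_asymp
  then have "(\<lambda>k. box_bump (1 / real (Suc k)) a b x) \<longlonglongrightarrow> (\<Prod>i\<in>(UNIV :: 'a set). 1 * 1)"
    unfolding box_bump_def using True by (intro tendsto_prod tendsto_mult) (auto simp: mem_box_cart)
  then show ?thesis using True by simp
next
  case False
  then have "box_bump (1 / real (Suc k)) a b x = 0" for k
    using box_bump_nonzero_iff by blast
  then show ?thesis using False by simp
qed

section \<open>The fundamental lemma of the calculus of variations\<close>

lemma L2_integrable_mult:
  assumes "v \<in> L2 \<Omega>" "w \<in> L2 \<Omega>"
  shows "integrable (lebesgue_on \<Omega>) (\<lambda>x. v x * w x)"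
proof (rule Bochner_Integration.integrable_bound)
  show "integrable (lebesgue_on \<Omega>) (\<lambda>x. (v x)\<^sup>2 + (w x)\<^sup>2)"
    using assms by (auto simp: L2_def)
  have "\<bar>v x * w x\<bar> \<le> (v x)\<^sup>2 + (w x)\<^sup>2" for x
  proof -
    have "2 * \<bar>v x\<bar> * \<bar>w x\<bar> \<le> \<bar>v x\<bar>\<^sup>2 + \<bar>w x\<bar>\<^sup>2" by (rule sum_squares_bound)
    moreover have "0 \<le> \<bar>v x\<bar> * \<bar>w x\<bar>" by simp
    ultimately show ?thesis unfolding abs_mult power2_abs by linarith
  qed
  then show "AE x in lebesgue_on \<Omega>. norm (v x * w x) \<le> norm ((v x)\<^sup>2 + (w x)\<^sup>2)"
    by (intro AE_I2) auto
qed (use assms in \<open>auto simp: L2_def\<close>)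

lemma L2_lincomb:
  assumes "v \<in> L2 \<Omega>" "w \<in> L2 \<Omega>"
  shows "(\<lambda>x. a * v x + b * w x) \<in> L2 \<Omega>"
proof -
  have "integrable (lebesgue_on \<Omega>) (\<lambda>x. a\<^sup>2 * (v x)\<^sup>2 + b\<^sup>2 * (w x)\<^sup>2 + 2 * a * b * (v x * w x))"
    using assms L2_integrable_mult[OF assms] by (auto simp: L2_def)
  then show ?thesis
    using assms by (auto simp: L2_def power2_eq_square algebra_simps)
qed

lemma pairing_lincomb_right:
  assumes "w \<in> L2 \<Omega>" "v1 \<in> L2 \<Omega>" "v2 \<in> L2 \<Omega>"
  shows "pairing \<Omega> w (\<lambda>x. a * v1 x + b * v2 x) = a * pairing \<Omega> w v1 + b * pairing \<Omega> w v2"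
proof -
  have "pairing \<Omega> w (\<lambda>x. a * v1 x + b * v2 x)
      = (LINT x|lebesgue_on \<Omega>. a * (w x * v1 x) + b * (w x * v2 x))"
    by (simp add: pairing_def algebra_simps)
  also have "\<dots> = a * pairing \<Omega> w v1 + b * pairing \<Omega> w v2"
    using L2_integrable_mult[OF assms(1,2)] L2_integrable_mult[OF assms(1,3)]
    by (simp add: pairing_def)
  finally show ?thesis .
qed

lemma pairing_commute: "pairing \<Omega> v w = pairing \<Omega> w v"
  by (simp add: pairing_def mult.commute)

lemma pairing_lincomb_left:
  assumes "v1 \<in> L2 \<Omega>" "v2 \<in> L2 \<Omega>" "w \<in> L2 \<Omega>"
  shows "pairing \<Omega> (\<lambda>x. a * v1 x + b * v2 x) w = a * pairing \<Omega> v1 w + b * pairing \<Omega> v2 w"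
  using pairing_lincomb_right[OF assms(3,1,2)] by (simp add: pairing_commute)

lemma box_indicator_L2:
  assumes "\<Omega> \<in> sets lebesgue"
  shows "indicat_real (box a b) \<in> L2 \<Omega>"
proof -
  have "integrable (lebesgue_on \<Omega>) (indicat_real (box a b))"
    using assms integrable_mult_indicator[of \<Omega> lebesgue "indicat_real (box a b)"]
      integrable_real_indicator[of "box a b" lebesgue]
    by (auto simp: integrable_restrict_space emeasure_lborel_box_eq)
  then show ?thesis
    by (simp add: L2_def power2_eq_square flip: indicator_inter_arith)
qed

lemma orthogonal_to_box_indicators:
  fixes g :: "'n::finite fn"
  assumes "open \<Omega>" and g: "g \<in> L2 \<Omega>"
    and orth: "\<forall>\<phi>\<in>test_functions \<Omega>. pairing \<Omega> g \<phi> = 0"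
    and sub: "cbox a b \<subseteq> \<Omega>"
  shows "pairing \<Omega> g (indicat_real (box a b)) = 0"
proof -
  let ?b = "\<lambda>k. box_bump (1 / real (Suc k)) a b"
  have \<Omega>: "\<Omega> \<in> sets lebesgue" using assms by auto
  have test: "?b k \<in> test_functions \<Omega>" for k
    by (rule box_bump_in_test_functions) (use sub in auto)
  have meas: "?b k \<in> borel_measurable (lebesgue_on \<Omega>)" for k
  proof -
    have "Ck 0 (?b k)" using test[of k] by (auto simp: test_functions_def)
    then have "continuous_on \<Omega> (?b k)" by (auto intro: continuous_on_subset)
    then show ?thesis using \<Omega> continuous_imp_measurable_on_sets_lebesgue by blast
  qed
  have "(\<lambda>k. LINT x|lebesgue_on \<Omega>. g x * ?b k x)
          \<longlonglongrightarrow> (LINT x|lebesgue_on \<Omega>. g x * indicat_real (box a b) x)"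
  proof (rule integral_dominated_convergence)
    show "integrable (lebesgue_on \<Omega>) (\<lambda>x. \<bar>g x * indicat_real (box a b) x\<bar>)"
      using L2_integrable_mult[OF g box_indicator_L2[OF \<Omega>]] by (rule integrable_abs)
    show "AE x in lebesgue_on \<Omega>. norm (g x * ?b k x) \<le> \<bar>g x * indicat_real (box a b) x\<bar>" for k
      using box_bump_bound[of "1 / real (Suc k)" a b] by (auto simp: abs_mult intro!: mult_left_mono AE_I2)
    show "AE x in lebesgue_on \<Omega>. (\<lambda>k. g x * ?b k x) \<longlonglongrightarrow> g x * indicat_real (box a b) x"
      by (intro AE_I2 tendsto_mult tendsto_const box_bump_tendsto)
  qed (use g meas box_indicator_L2[OF \<Omega>] in \<open>unfold L2_def, blast intro: borel_measurable_times\<close>)+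
  then show ?thesis
    using orth test by (auto simp: pairing_def LIMSEQ_const_iff)
qed

text \<open>
  Boxes form an intersection-stable generator of the Borel sets, and the sets with vanishing integral form
  a Dynkin system once the total integral vanishes.
\<close>

lemma zero_box_integrals_imp_AE_zero:
  fixes h :: "'a::euclidean_space \<Rightarrow> real"
  assumes int: "integrable lborel h" and "integral\<^sup>L lborel h = 0"
    and box: "\<And>a b. (LINT x:box a b|lborel. h x) = 0"
  shows "AE x in lborel. h x = 0"
proof (rule density_unique_real)
  show "integrable lborel h" by fact
  let ?G = "range (\<lambda>(a, b). box a b :: 'a set)"
  fix A :: "'a set" assume "A \<in> sets lborel"
  then have A: "A \<in> sigma_sets UNIV ?G" by (simp add: borel_eq_box)
  have borel: "B \<in> sets borel" if "B \<in> sigma_sets UNIV ?G" for B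
    using that by (simp add: borel_eq_box)
  have "\<exists>c d. box a b \<inter> box p q = box c d" for a b p q :: 'a
    unfolding box_Int_box by blast
  then have "Int_stable ?G" by (fastforce simp: Int_stable_def image_iff)
  moreover have "?G \<subseteq> Pow UNIV" by simp
  ultimately have "(LINT x:A|lborel. h x) = 0"
    using A
  proof (induction rule: sigma_sets_induct_disjoint)
    case (compl A)
    have A: "set_integrable lborel A h"
      unfolding set_integrable_def using int borel[OF compl.hyps] by (intro integrable_mult_indicator) auto
    have "(LINT x:UNIV - A|lborel. h x) = (LINT x|lborel. h x - indicator A x *\<^sub>R h x)"
      unfolding set_lebesgue_integral_def by (intro Bochner_Integration.integral_cong) (auto simp: indicator_def)
    also have "\<dots> = 0"
      using compl.IH A int assms(2) by (simp add: set_lebesgue_integral_def set_integrable_def)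
    finally show ?case .
  next
    case (union A)
    have "(LINT x:(\<Union>i. A i)|lborel. h x) = (\<Sum>i. LINT x:A i|lborel. h x)"
    proof (rule lebesgue_integral_countable_add)
      show "A i \<in> sets lborel" for i using union borel by auto
      then show "set_integrable lborel (\<Union>i. A i) h"
        unfolding set_integrable_def using int by (intro integrable_mult_indicator) auto
    qed (use union.hyps in \<open>auto simp: disjoint_family_on_def\<close>)
    then show ?case using union by simp
  qed (use box in \<open>auto simp: set_lebesgue_integral_def\<close>)
  then show "(LINT x:A|lborel. h x) = (LINT x:A|lborel. 0)" by simp
qed simp

text \<open>
  The domain is a countable union of closed boxes. On each of them the function is replaced by a Borel
  representative whose integral over every box vanishes.
\<close>

lemma fundamental_lemma_calculus_of_variations:
  fixes g :: "'n::finite fn"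
  assumes \<Omega>: "open \<Omega>" and g: "g \<in> L2 \<Omega>"
    and orth: "\<forall>\<phi>\<in>test_functions \<Omega>. pairing \<Omega> g \<phi> = 0"
  shows "AE x in lebesgue_on \<Omega>. g x = 0"
proof -
  have \<Omega>': "\<Omega> \<in> sets lebesgue" using assms by auto
  have box0: "AE x in lebesgue. x \<in> box p q \<longrightarrow> g x = 0" if sub: "cbox p q \<subseteq> \<Omega>" for p q
  proof -
    have pq: "box p q \<subseteq> \<Omega>" using sub box_subset_cbox by blast
    let ?h = "\<lambda>x. indicat_real (box p q) x * g x"
    have eq: "(\<lambda>x. indicator \<Omega> x *\<^sub>R (g x * indicat_real (box p q) x)) = ?h"
      using pq by (auto simp: indicator_def fun_eq_iff)
    have "integrable lebesgue ?h"
      unfolding eq[symmetric]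
      using L2_integrable_mult[OF g box_indicator_L2[OF \<Omega>', of p q]] \<Omega>'
      by (subst integrable_restrict_space[symmetric]) auto
    then obtain h where h: "h \<in> borel_measurable lborel" "AE x in lborel. ?h x = h x"
      using completion_ex_borel_measurable_real by blast
    then have ae: "AE x in lebesgue. ?h x = h x" by (auto intro: AE_completion)
    have hm: "h \<in> borel_measurable lebesgue" using h(1) by (rule measurable_completion)
    have "integrable lebesgue h"
      using \<open>integrable lebesgue ?h\<close> ae hm by (subst integrable_cong_AE[symmetric]) auto
    then have int: "integrable lborel h" using h by (simp add: integrable_completion)
    have box: "(LINT x:box a b|lborel. h x) = 0" for a b :: "real^'n"
    proof -
      obtain c d where cd: "box a b \<inter> box p q = box c d" "cbox c d \<subseteq> cbox p q"
      proof (cases "box a b \<inter> box p q = {}")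
        case True
        have "box One 0 = ({} :: (real^'n) set)"
          using empty_as_interval box_subset_cbox by blast
        then show ?thesis using True that empty_as_interval by blast
      next
        case False
        obtain c d where cd: "box a b \<inter> box p q = box c d" unfolding box_Int_box by blast
        then have "cbox c d = closure (box c d)" using False by (simp add: closure_box)
        also have "\<dots> \<subseteq> cbox p q"
          using cd box_subset_cbox[of p q] by (intro closure_minimal) auto
        finally show ?thesis using that cd by blast
      qed
      have "(LINT x:box a b|lborel. h x) = (LINT x|lebesgue. indicator (box a b) x *\<^sub>R h x)"
        unfolding set_lebesgue_integral_def using h(1) by (intro integral_completion[symmetric]) auto
      also have "\<dots> = (LINT x|lebesgue. indicator (box a b) x *\<^sub>R ?h x)"
        using ae borel_measurable_integrable[OF \<open>integrable lebesgue ?h\<close>] hm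
        by (intro integral_cong_AE borel_measurable_scaleR borel_measurable_indicator) auto
      also have "\<dots> = (LINT x|lebesgue. indicator \<Omega> x *\<^sub>R (g x * indicat_real (box c d) x))"
        using pq by (intro Bochner_Integration.integral_cong) (auto simp: indicator_def simp flip: cd(1))
      also have "\<dots> = pairing \<Omega> g (indicat_real (box c d))"
        using \<Omega>' by (simp add: pairing_def integral_restrict_space)
      also have "\<dots> = 0"
        using orthogonal_to_box_indicators[OF \<Omega> g orth] cd(2) sub by blast
      finally show ?thesis .
    qed
    have "integral\<^sup>L lborel h = integral\<^sup>L lebesgue h"
      using h(1) by (rule integral_completion[symmetric])
    also have "\<dots> = (LINT x|lebesgue. indicator \<Omega> x *\<^sub>R (g x * indicat_real (box p q) x))"
      unfolding eq using ae \<open>integrable lebesgue ?h\<close> hm by (intro integral_cong_AE) auto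
    also have "\<dots> = pairing \<Omega> g (indicat_real (box p q))"
      using \<Omega>' by (simp add: pairing_def integral_restrict_space)
    also have "\<dots> = 0"
      using orthogonal_to_box_indicators[OF \<Omega> g orth sub] .
    finally have "AE x in lborel. h x = 0"
      using zero_box_integrals_imp_AE_zero[OF int _ box] by blast
    then have "AE x in lebesgue. h x = 0" by (rule AE_completion)
    with ae show ?thesis by eventually_elim (auto simp: indicator_def split: if_splits)
  qed
  (* The boxes are closed so that they fit into the domain together with the support of
     the bumps; their boundaries are negligible. *)
  obtain \<D> where \<D>: "countable \<D>" "\<D> \<subseteq> Pow \<Omega>" "\<And>X. X \<in> \<D> \<Longrightarrow> \<exists>a b. X = cbox a b" "\<Union>\<D> = \<Omega>"
    using open_countable_Union_open_cbox[OF \<Omega>] by metis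
  have "AE x in lebesgue. x \<in> X \<longrightarrow> g x = 0" if XD: "X \<in> \<D>" for X
  proof -
    obtain a b where X: "X = cbox a b" using \<D>(3)[OF XD] by blast
    have "negligible (cbox a b - box a b)" by (rule negligible_frontier_interval)
    then have "AE x in lebesgue. x \<notin> cbox a b - box a b"
      by (intro AE_not_in) (simp add: negligible_iff_null_sets)
    moreover have "AE x in lebesgue. x \<in> box a b \<longrightarrow> g x = 0"
      using \<D>(2) XD X by (intro box0) auto
    ultimately show ?thesis unfolding X by eventually_elim auto
  qed
  then have "AE x in lebesgue. \<forall>X\<in>\<D>. x \<in> X \<longrightarrow> g x = 0"
    using \<D>(1) by (subst AE_ball_countable) auto
  then show ?thesis
    using \<Omega>' \<D>(4) by (subst AE_restrict_space_iff) (auto elim!: eventually_mono)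
qed

section \<open>Integration by parts for test functions\<close>

lemma partial_deriv_along_line:
  fixes h :: "'n::finite fn"
  assumes "\<forall>x. h differentiable at x"
  shows "((\<lambda>s. h (x + s *\<^sub>R axis i 1)) has_real_derivative partial_deriv i h (x + s *\<^sub>R axis i 1)) (at s)"
proof -
  let ?y = "x + s *\<^sub>R axis i 1 :: real^'n"
  have h: "(h has_derivative frechet_derivative h (at ?y)) (at ?y)"
    using assms by (simp add: frechet_derivative_works)
  have "((\<lambda>s. x + s *\<^sub>R axis i 1) has_derivative (\<lambda>r. r *\<^sub>R axis i 1)) (at s)"
    by (auto intro!: derivative_eq_intros)
  from has_derivative_compose[OF this h]
  have "((\<lambda>s. h (x + s *\<^sub>R axis i 1)) has_derivative (\<lambda>r. frechet_derivative h (at ?y) (r *\<^sub>R axis i 1))) (at s)" .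
  moreover have "frechet_derivative h (at ?y) (r *\<^sub>R axis i 1) = partial_deriv i h ?y * r" for r
    using linear_scale[OF has_derivative_linear[OF h]] by (simp add: partial_deriv_def)
  ultimately show ?thesis by (simp add: has_field_derivative_def)
qed

lemma integrable_compact_support:
  fixes f :: "'a::euclidean_space \<Rightarrow> real"
  assumes "compact K" "continuous_on UNIV f" "\<And>x. x \<notin> K \<Longrightarrow> f x = 0"
  shows "integrable lborel f"
proof -
  have "integrable lborel (\<lambda>x. indicator K x *\<^sub>R f x)"
    using assms by (intro borel_integrable_compact) (auto intro: continuous_on_subset)
  moreover have "(\<lambda>x. indicator K x *\<^sub>R f x) = f"
    using assms(3) by (auto simp: indicator_def fun_eq_iff)
  ultimately show ?thesis by simp
qed

text \<open>
  The integral of a difference quotient vanishes because Lebesgue measure is invariant under translations;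
  compact support and a bounded derivative allow passing to the limit under the integral.
\<close>

lemma integral_partial_deriv_eq_zero:
  fixes h :: "'n::finite fn"
  assumes diff: "\<forall>x. h differentiable at x" and cont: "continuous_on UNIV (partial_deriv i h)"
    and K: "compact K" and supp: "\<And>x. x \<notin> K \<Longrightarrow> h x = 0"
  shows "integral\<^sup>L lborel (partial_deriv i h) = 0"
proof -
  let ?e = "axis i 1 :: real^'n"
  let ?q = "\<lambda>k x. real (Suc k) * (h (x + (1 / real (Suc k)) *\<^sub>R ?e) - h x)"
  have hcont: "continuous_on UNIV h"
    using diff by (intro differentiable_imp_continuous_on) (auto simp: differentiable_on_def)
  have h: "integrable lborel h" by (rule integrable_compact_support[OF K hcont supp])
  have trans: "has_bochner_integral lborel (\<lambda>x. h (x + c)) (integral\<^sup>L lborel h)" for c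
  proof -
    have "has_bochner_integral (distr lborel borel ((+) c)) h (integral\<^sup>L lborel h)"
      using h by (simp add: lborel_distr_plus has_bochner_integral_integrable)
    moreover have "(+) c \<in> lborel \<rightarrow>\<^sub>M borel" by simp
    moreover have "h \<in> borel_measurable borel" using hcont by (rule borel_measurable_continuous_onI)
    ultimately have "has_bochner_integral lborel (\<lambda>x. h (c + x)) (integral\<^sup>L lborel h)"
      unfolding has_bochner_integral_iff by (simp only: integrable_distr_eq integral_distr)
    then show ?thesis by (simp add: add.commute)
  qed
  (* The difference quotients vanish outside one compact set, and for x in that set the mean value
     theorem evaluates the derivative in a second one. *)
  define S where "S = (\<lambda>s. s *\<^sub>R ?e) ` {0..1::real}"
  define K' where "K' = {x - y | x y. x \<in> K \<and> y \<in> S}"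
  define K'' where "K'' = {x + y | x y. x \<in> K' \<and> y \<in> S}"
  have "compact S" unfolding S_def
    by (intro compact_continuous_image) (auto intro!: continuous_intros)
  then have K': "compact K'" unfolding K'_def using K by (intro compact_differences)
  then have K'': "compact K''" unfolding K''_def using \<open>compact S\<close> by (rule compact_sums)
  have "bounded (partial_deriv i h ` K'')"
    using K'' cont by (intro compact_imp_bounded compact_continuous_image) (auto intro: continuous_on_subset)
  then obtain B where B: "\<And>x. x \<in> K'' \<Longrightarrow> \<bar>partial_deriv i h x\<bar> \<le> B"
    by (auto simp: bounded_iff)
  have bound: "\<bar>?q k x\<bar> \<le> B * indicat_real K' x" for k x
  proof -
    let ?t = "1 / real (Suc k)"
    have t: "0 < ?t" "?t \<le> 1" by auto
    show ?thesis
    proof (cases "x \<in> K'")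
      case True
      have "\<exists>z. 0 < z \<and> z < ?t \<and> h (x + ?t *\<^sub>R ?e) - h (x + 0 *\<^sub>R ?e)
          = (?t - 0) * partial_deriv i h (x + z *\<^sub>R ?e)"
        by (rule MVT2[OF t(1)]) (rule partial_deriv_along_line[OF diff])
      then obtain z where z: "0 < z" "z < ?t"
        and eq: "h (x + ?t *\<^sub>R ?e) - h x = ?t * partial_deriv i h (x + z *\<^sub>R ?e)"
        by auto
      have "z \<le> 1" using z(2) t(2) by linarith
      then have "z *\<^sub>R ?e \<in> S" using z(1) unfolding S_def by (intro imageI) auto
      then have "x + z *\<^sub>R ?e \<in> K''" using True by (auto simp: K''_def)
      then show ?thesis using B True unfolding eq by simp
    next
      case False
      have "x + s *\<^sub>R ?e \<notin> K" if "0 \<le> s" "s \<le> 1" for s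
      proof
        assume "x + s *\<^sub>R ?e \<in> K"
        moreover have "s *\<^sub>R ?e \<in> S" using that unfolding S_def by (intro imageI) auto
        moreover have "x = (x + s *\<^sub>R ?e) - s *\<^sub>R ?e" by simp
        ultimately show False using False unfolding K'_def by blast
      qed
      from this[of 0] this[of ?t] show ?thesis using supp False t by simp
    qed
  qed
  have lim: "(\<lambda>k. ?q k x) \<longlonglongrightarrow> partial_deriv i h x" for x
  proof -
    have "((\<lambda>s. h (x + s *\<^sub>R ?e)) has_real_derivative partial_deriv i h x) (at 0)"
      using partial_deriv_along_line[OF diff, of x i 0] by simp
    then have "((\<lambda>s. (h (x + s *\<^sub>R ?e) - h x) / s) \<longlongrightarrow> partial_deriv i h x) (at 0)"
      by (simp add: DERIV_def)
    moreover have "filterlim (\<lambda>k. 1 / real (Suc k)) (at 0) sequentially"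
      unfolding filterlim_at using LIMSEQ_Suc[OF lim_1_over_n[where 'a = real]] by simp
    ultimately have "(\<lambda>k. (h (x + (1 / real (Suc k)) *\<^sub>R ?e) - h x) / (1 / real (Suc k)))
        \<longlonglongrightarrow> partial_deriv i h x"
      by (rule filterlim_compose)
    then show ?thesis by (simp add: mult.commute)
  qed
  have "(\<lambda>k. integral\<^sup>L lborel (?q k)) \<longlonglongrightarrow> integral\<^sup>L lborel (partial_deriv i h)"
  proof (rule integral_dominated_convergence)
    show "integrable lborel (\<lambda>x. B * indicat_real K' x)"
      using borel_compact[OF K'] emeasure_compact_finite[OF K']
      by (intro integrable_mult_right integrable_real_indicator) auto
    show "partial_deriv i h \<in> borel_measurable lborel"
      using cont by (simp add: borel_measurable_continuous_onI)
    show "?q k \<in> borel_measurable lborel" for k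
      using h trans by (intro borel_measurable_integrable integrable_mult_right
          Bochner_Integration.integrable_diff) (auto simp: has_bochner_integral_iff)
  qed (use bound lim in auto)
  moreover have "integral\<^sup>L lborel (?q k) = 0" for k
    using h trans[of "(1 / real (Suc k)) *\<^sub>R ?e"] by (simp add: has_bochner_integral_iff)
  ultimately show ?thesis by (simp add: LIMSEQ_const_iff)
qed

lemma test_functionD:
  fixes \<phi> :: "'n::finite fn"
  assumes "\<phi> \<in> test_functions \<Omega>"
  shows "\<forall>x. \<phi> differentiable at x" and "continuous_on UNIV \<phi>"
    and "continuous_on UNIV (partial_deriv i \<phi>)"
    and "compact (closure {x. \<phi> x \<noteq> 0})" and "closure {x. \<phi> x \<noteq> 0} \<subseteq> \<Omega>"
    and "x \<notin> closure {x. \<phi> x \<noteq> 0} \<Longrightarrow> \<phi> x = 0"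
    and "x \<notin> closure {x. \<phi> x \<noteq> 0} \<Longrightarrow> partial_deriv i \<phi> x = 0"
proof -
  let ?K = "closure {x. \<phi> x \<noteq> 0}"
  have Ck: "Ck k \<phi>" for k using assms by (simp add: test_functions_def)
  show "\<forall>x. \<phi> differentiable at x" "continuous_on UNIV \<phi>" "continuous_on UNIV (partial_deriv i \<phi>)"
    using Ck[of 0] Ck[of "Suc 0"] by auto
  show "compact ?K" "?K \<subseteq> \<Omega>" using assms by (auto simp: test_functions_def)
  have zero: "\<phi> y = 0" if "y \<notin> ?K" for y
  proof (rule ccontr)
    assume "\<phi> y \<noteq> 0"
    then have "y \<in> ?K" by (intro subsetD[OF closure_subset]) blast
    with that show False by contradiction
  qed
  show "\<phi> x = 0" if "x \<notin> ?K" using that by (rule zero)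
  show "partial_deriv i \<phi> x = 0" if "x \<notin> ?K"
  proof -
    have "(\<phi> has_derivative (\<lambda>_. 0)) (at x)"
    proof (rule has_derivative_transform_within_open[OF has_derivative_const[of 0]])
      show "open (- ?K)" by (simp only: open_Compl closed_closure)
      show "x \<in> - ?K" using that by (simp only: Compl_iff not_False_eq_True)
      show "0 = \<phi> y" if "y \<in> - ?K" for y using zero[OF ComplD[OF that]] by (rule sym)
    qed
    then show ?thesis by (rule partial_deriv_eqI)
  qed
qed

lemma compact_support_L2:
  fixes f :: "'n::finite fn"
  assumes "\<Omega> \<in> sets lebesgue" "compact K" "continuous_on UNIV f" "\<And>x. x \<notin> K \<Longrightarrow> f x = 0"
  shows "f \<in> L2 \<Omega>"
proof -
  have "integrable lborel (\<lambda>x. (f x)\<^sup>2)"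
    by (rule integrable_compact_support[OF assms(2)]) (use assms in \<open>auto intro!: continuous_intros\<close>)
  then have "integrable lebesgue (\<lambda>x. (f x)\<^sup>2)"
    using assms(3) by (subst integrable_completion) (auto simp: borel_measurable_continuous_onI)
  then have "integrable (lebesgue_on \<Omega>) (\<lambda>x. (f x)\<^sup>2)"
    using assms(1) by (subst integrable_restrict_space) (auto intro: integrable_mult_indicator simp del: real_scaleR_def)
  moreover have "f \<in> borel_measurable (lebesgue_on \<Omega>)"
    using assms by (meson continuous_imp_measurable_on_sets_lebesgue continuous_on_subset subset_UNIV)
  ultimately show ?thesis by (simp add: L2_def)
qed

lemma test_function_L2:
  assumes "\<Omega> \<in> sets lebesgue" "\<phi> \<in> test_functions \<Omega>"
  shows "\<phi> \<in> L2 \<Omega>" and "partial_deriv i \<phi> \<in> L2 \<Omega>"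
  by (rule compact_support_L2[OF assms(1) test_functionD(4)[OF assms(2)]];
      rule test_functionD[OF assms(2)]; assumption)+

lemma pairing_eq_integral_lborel:
  fixes v w :: "'n::finite fn"
  assumes "\<Omega> \<in> sets lebesgue" "continuous_on UNIV v" "continuous_on UNIV w"
    and "\<And>x. x \<notin> \<Omega> \<Longrightarrow> v x * w x = 0"
  shows "pairing \<Omega> v w = (LINT x|lborel. v x * w x)"
proof -
  have "pairing \<Omega> v w = (LINT x|lebesgue. indicator \<Omega> x *\<^sub>R (v x * w x))"
    using assms(1) by (simp add: pairing_def integral_restrict_space)
  also have "\<dots> = (LINT x|lebesgue. v x * w x)"
    using assms(4) by (intro Bochner_Integration.integral_cong) (auto simp: indicator_def)
  also have "\<dots> = (LINT x|lborel. v x * w x)"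
    using assms(2,3) by (intro integral_completion) (auto intro!: borel_measurable_continuous_onI continuous_intros)
  finally show ?thesis .
qed

text \<open>
  Integration by parts: the product of two test functions has compact support, so its partial derivatives
  integrate to 0.
\<close>

lemma test_function_weak_grad:
  fixes \<phi> :: "'n::finite fn"
  assumes \<Omega>: "\<Omega> \<in> sets lebesgue" and \<phi>: "\<phi> \<in> test_functions \<Omega>"
  shows "is_weak_grad \<Omega> \<phi> (\<lambda>x. \<chi> i. partial_deriv i \<phi> x)"
  unfolding is_weak_grad_def
proof (intro conjI ballI allI)
  show "(\<lambda>x. (\<chi> i. partial_deriv i \<phi> x) $ i) \<in> L2 \<Omega>" for i
    using test_function_L2(2)[OF assms] by simp
  fix \<psi> i assume \<psi>: "\<psi> \<in> test_functions \<Omega>"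
  note d\<phi> = test_functionD[OF \<phi>] and d\<psi> = test_functionD[OF \<psi>]
  let ?h = "\<lambda>x. \<phi> x * \<psi> x"
  have pd: "partial_deriv i ?h = (\<lambda>x. \<phi> x * partial_deriv i \<psi> x + partial_deriv i \<phi> x * \<psi> x)"
  proof
    fix x
    have "(\<phi> has_derivative frechet_derivative \<phi> (at x)) (at x)"
         "(\<psi> has_derivative frechet_derivative \<psi> (at x)) (at x)"
      using d\<phi>(1) d\<psi>(1) by (auto simp: frechet_derivative_works)
    from partial_deriv_eqI[OF has_derivative_mult[OF this]]
    show "partial_deriv i ?h x = \<phi> x * partial_deriv i \<psi> x + partial_deriv i \<phi> x * \<psi> x"
      by (simp add: partial_deriv_def)
  qed
  have off: "\<phi> x = 0" "\<psi> x = 0" if "x \<notin> \<Omega>" for x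
    using d\<phi>(6)[of x] d\<psi>(6)[of x] subsetD[OF d\<phi>(5), of x] subsetD[OF d\<psi>(5), of x] that
    by blast+
  have int: "integrable lborel (\<lambda>x. \<phi> x * partial_deriv i \<psi> x)"
    by (intro integrable_compact_support[OF d\<phi>(4)] continuous_intros d\<phi>(2) d\<psi>(3))
       (simp only: d\<phi>(6) mult_zero_left simp_thms)
  have int': "integrable lborel (\<lambda>x. partial_deriv i \<phi> x * \<psi> x)"
    by (intro integrable_compact_support[OF d\<phi>(4)] continuous_intros d\<phi>(3) d\<psi>(2))
       (simp only: d\<phi>(7) mult_zero_left simp_thms)
  have "0 = integral\<^sup>L lborel (partial_deriv i ?h)"
  proof (rule integral_partial_deriv_eq_zero[symmetric, OF _ _ d\<phi>(4)])
    show "\<forall>x. ?h differentiable at x" using d\<phi>(1) d\<psi>(1) by auto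
    show "continuous_on UNIV (partial_deriv i ?h)"
      unfolding pd using d\<phi>(2,3) d\<psi>(2,3) by (intro continuous_intros) auto
  qed (simp only: d\<phi>(6) mult_zero_left simp_thms)
  also have "\<dots> = (LINT x|lborel. \<phi> x * partial_deriv i \<psi> x) + (LINT x|lborel. partial_deriv i \<phi> x * \<psi> x)"
    unfolding pd using int int' by (rule Bochner_Integration.integral_add)
  also have "(LINT x|lborel. \<phi> x * partial_deriv i \<psi> x) = pairing \<Omega> \<phi> (partial_deriv i \<psi>)"
    using \<Omega> d\<phi>(2) d\<psi>(3) off by (intro pairing_eq_integral_lborel[symmetric]) auto
  also have "(LINT x|lborel. partial_deriv i \<phi> x * \<psi> x) = pairing \<Omega> (partial_deriv i \<phi>) \<psi>"
    using \<Omega> d\<phi>(3) d\<psi>(2) off by (intro pairing_eq_integral_lborel[symmetric]) auto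
  finally show "pairing \<Omega> \<phi> (partial_deriv i \<psi>) = - pairing \<Omega> (\<lambda>x. (\<chi> i. partial_deriv i \<phi> x) $ i) \<psi>"
    by simp
qed

section \<open>The space \<open>H\<^sub>0\<^sup>1\<close>\<close>

lemma weak_grad_AE_unique:
  fixes w :: "'n::finite fn"
  assumes "open \<Omega>" "is_weak_grad \<Omega> w g" "is_weak_grad \<Omega> w h"
  shows "AE x in lebesgue_on \<Omega>. g x = h x"
proof -
  have "AE x in lebesgue_on \<Omega>. g x $ i = h x $ i" for i
  proof -
    let ?d = "\<lambda>x. 1 * g x $ i + (- 1) * h x $ i"
    have L2: "(\<lambda>x. g x $ i) \<in> L2 \<Omega>" "(\<lambda>x. h x $ i) \<in> L2 \<Omega>"
      using assms by (auto simp: is_weak_grad_def)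
    have "pairing \<Omega> ?d \<phi> = 0" if \<phi>: "\<phi> \<in> test_functions \<Omega>" for \<phi>
    proof -
      have "\<phi> \<in> L2 \<Omega>" using assms(1) \<phi> by (auto intro: test_function_L2)
      then have "pairing \<Omega> ?d \<phi> = 1 * pairing \<Omega> (\<lambda>x. g x $ i) \<phi> + (- 1) * pairing \<Omega> (\<lambda>x. h x $ i) \<phi>"
        by (rule pairing_lincomb_left[OF L2])
      also have "pairing \<Omega> (\<lambda>x. g x $ i) \<phi> = - pairing \<Omega> w (partial_deriv i \<phi>)"
        using assms(2) \<phi> unfolding is_weak_grad_def by simp
      also have "pairing \<Omega> (\<lambda>x. h x $ i) \<phi> = - pairing \<Omega> w (partial_deriv i \<phi>)"
        using assms(3) \<phi> unfolding is_weak_grad_def by simp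
      finally show ?thesis by simp
    qed
    then have "AE x in lebesgue_on \<Omega>. ?d x = 0"
      using L2_lincomb[OF L2, of 1 "- 1"] by (intro fundamental_lemma_calculus_of_variations[OF assms(1)]) blast+
    then show ?thesis by eventually_elim simp
  qed
  then have "AE x in lebesgue_on \<Omega>. \<forall>i. g x $ i = h x $ i"
    by (simp add: AE_all_countable)
  then show ?thesis by (simp add: vec_eq_iff)
qed

lemma is_weak_grad_lincomb:
  fixes v w :: "'n::finite fn"
  assumes \<Omega>: "open \<Omega>" and v: "v \<in> L2 \<Omega>" "is_weak_grad \<Omega> v g" and w: "w \<in> L2 \<Omega>" "is_weak_grad \<Omega> w h"
  shows "is_weak_grad \<Omega> (\<lambda>x. a * v x + b * w x) (\<lambda>x. a *\<^sub>R g x + b *\<^sub>R h x)"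
  unfolding is_weak_grad_def
proof (intro conjI allI ballI)
  have L2: "(\<lambda>x. g x $ i) \<in> L2 \<Omega>" "(\<lambda>x. h x $ i) \<in> L2 \<Omega>" for i
    using v w by (auto simp: is_weak_grad_def)
  show "(\<lambda>x. (a *\<^sub>R g x + b *\<^sub>R h x) $ i) \<in> L2 \<Omega>" for i
    using L2_lincomb[OF L2] by simp
  fix \<phi> i assume \<phi>: "\<phi> \<in> test_functions \<Omega>"
  have \<phi>L2: "\<phi> \<in> L2 \<Omega>" "partial_deriv i \<phi> \<in> L2 \<Omega>"
    using \<Omega> \<phi> by (auto intro: test_function_L2)
  have "pairing \<Omega> v (partial_deriv i \<phi>) = - pairing \<Omega> (\<lambda>x. g x $ i) \<phi>"
    "pairing \<Omega> w (partial_deriv i \<phi>) = - pairing \<Omega> (\<lambda>x. h x $ i) \<phi>"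
    using v(2) w(2) \<phi> unfolding is_weak_grad_def by simp_all
  then show "pairing \<Omega> (\<lambda>x. a * v x + b * w x) (partial_deriv i \<phi>)
      = - pairing \<Omega> (\<lambda>x. (a *\<^sub>R g x + b *\<^sub>R h x) $ i) \<phi>"
    using pairing_lincomb_left[OF v(1) w(1) \<phi>L2(2), of a b]
      pairing_lincomb_left[OF L2(1)[of i] L2(2)[of i] \<phi>L2(1), of a b]
    by simp
qed

lemma weak_grad_works: "w \<in> H1 \<Omega> \<Longrightarrow> is_weak_grad \<Omega> w (weak_grad \<Omega> w)"
  unfolding weak_grad_def H1_def by (simp add: someI_ex)

lemma H1_lincomb:
  assumes "open \<Omega>" "v \<in> H1 \<Omega>" "w \<in> H1 \<Omega>"
  shows "(\<lambda>x. a * v x + b * w x) \<in> H1 \<Omega>"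
proof -
  obtain g h where "v \<in> L2 \<Omega>" "is_weak_grad \<Omega> v g" "w \<in> L2 \<Omega>" "is_weak_grad \<Omega> w h"
    using assms(2,3) by (auto simp: H1_def)
  then show ?thesis
    using is_weak_grad_lincomb[OF assms(1), of v g w h a b] L2_lincomb[of v \<Omega> w a b]
    unfolding H1_def by blast
qed

lemma integrable_grad_sq:
  fixes g :: "real^'n::finite \<Rightarrow> real^'n"
  assumes "is_weak_grad \<Omega> w g"
  shows "integrable (lebesgue_on \<Omega>) (\<lambda>x. (norm (g x))\<^sup>2)"
proof -
  have "(norm (g x))\<^sup>2 = (\<Sum>i\<in>UNIV. (g x $ i)\<^sup>2)" for x
    by (simp add: norm_vec_def L2_set_def sum_nonneg)
  then show ?thesis
    using assms by (auto simp: is_weak_grad_def L2_def intro!: Bochner_Integration.integrable_sum)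
qed

text \<open>
  Frees the norm from the weak gradient chosen in its definition.
\<close>

lemma H1_norm_sq:
  fixes w :: "'n::finite fn"
  assumes "open \<Omega>" "w \<in> L2 \<Omega>" "is_weak_grad \<Omega> w g"
  shows "(H1_norm \<Omega> w)\<^sup>2 = (LINT x|lebesgue_on \<Omega>. (w x)\<^sup>2 + (norm (g x))\<^sup>2)"
proof -
  have w: "is_weak_grad \<Omega> w (weak_grad \<Omega> w)"
    using assms by (intro weak_grad_works) (auto simp: H1_def)
  have "(H1_norm \<Omega> w)\<^sup>2 = (LINT x|lebesgue_on \<Omega>. (w x)\<^sup>2 + (norm (weak_grad \<Omega> w x))\<^sup>2)"
    unfolding H1_norm_def by (intro real_sqrt_pow2 Bochner_Integration.integral_nonneg) auto
  also have "\<dots> = (LINT x|lebesgue_on \<Omega>. (w x)\<^sup>2 + (norm (g x))\<^sup>2)"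
  proof (rule integral_cong_AE)
    show "AE x in lebesgue_on \<Omega>. (w x)\<^sup>2 + (norm (weak_grad \<Omega> w x))\<^sup>2 = (w x)\<^sup>2 + (norm (g x))\<^sup>2"
      using weak_grad_AE_unique[OF assms(1) w assms(3)] by eventually_elim simp
  qed (use assms(2) in \<open>auto simp: L2_def intro!: borel_measurable_add
         borel_measurable_integrable integrable_grad_sq[OF w] integrable_grad_sq[OF assms(3)]\<close>)
  finally show ?thesis .
qed

text \<open>
  A substitute for the triangle inequality: sequences tending to 0 in norm form a linear space, which is all
  that the closure of the test functions requires.
\<close>

lemma H1_norm_lincomb:
  fixes v w :: "'n::finite fn"
  assumes "open \<Omega>" "v \<in> H1 \<Omega>" "w \<in> H1 \<Omega>"
  shows "(H1_norm \<Omega> (\<lambda>x. a * v x + b * w x))\<^sup>2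
    \<le> 2 * a\<^sup>2 * (H1_norm \<Omega> v)\<^sup>2 + 2 * b\<^sup>2 * (H1_norm \<Omega> w)\<^sup>2"
proof -
  let ?g = "weak_grad \<Omega> v" and ?h = "weak_grad \<Omega> w"
  have v: "v \<in> L2 \<Omega>" "is_weak_grad \<Omega> v ?g" and w: "w \<in> L2 \<Omega>" "is_weak_grad \<Omega> w ?h"
    using assms weak_grad_works by (auto simp: H1_def)
  have young: "(norm (x + y))\<^sup>2 \<le> 2 * (norm x)\<^sup>2 + 2 * (norm y)\<^sup>2" for x y :: "'b::real_inner"
    using inner_ge_zero[of "x - y"]
    by (simp add: power2_norm_eq_inner inner_add inner_diff inner_commute)
  note sum = is_weak_grad_lincomb[OF assms(1) v w, of a b]
  have int: "integrable (lebesgue_on \<Omega>) (\<lambda>x. (v x)\<^sup>2 + (norm (?g x))\<^sup>2)"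
    "integrable (lebesgue_on \<Omega>) (\<lambda>x. (w x)\<^sup>2 + (norm (?h x))\<^sup>2)"
    using v(1) w(1) integrable_grad_sq[OF v(2)] integrable_grad_sq[OF w(2)] by (auto simp: L2_def)
  have "(H1_norm \<Omega> (\<lambda>x. a * v x + b * w x))\<^sup>2
     = (LINT x|lebesgue_on \<Omega>. (a * v x + b * w x)\<^sup>2 + (norm (a *\<^sub>R ?g x + b *\<^sub>R ?h x))\<^sup>2)"
    by (rule H1_norm_sq[OF assms(1) L2_lincomb[OF v(1) w(1)] sum])
  also have "\<dots> \<le> (LINT x|lebesgue_on \<Omega>. 2 * a\<^sup>2 * ((v x)\<^sup>2 + (norm (?g x))\<^sup>2)
      + 2 * b\<^sup>2 * ((w x)\<^sup>2 + (norm (?h x))\<^sup>2))"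
  proof (rule integral_mono)
    show "integrable (lebesgue_on \<Omega>) (\<lambda>x. (a * v x + b * w x)\<^sup>2 + (norm (a *\<^sub>R ?g x + b *\<^sub>R ?h x))\<^sup>2)"
      using L2_lincomb[OF v(1) w(1)] integrable_grad_sq[OF sum]
      by (intro Bochner_Integration.integrable_add) (auto simp: L2_def)
    show "(a * v x + b * w x)\<^sup>2 + (norm (a *\<^sub>R ?g x + b *\<^sub>R ?h x))\<^sup>2
      \<le> 2 * a\<^sup>2 * ((v x)\<^sup>2 + (norm (?g x))\<^sup>2) + 2 * b\<^sup>2 * ((w x)\<^sup>2 + (norm (?h x))\<^sup>2)" for x
      using young[of "a * v x" "b * w x"] young[of "a *\<^sub>R ?g x" "b *\<^sub>R ?h x"]
      by (simp add: power_mult_distrib algebra_simps)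
  qed (use int in \<open>auto intro!: Bochner_Integration.integrable_add integrable_mult_right\<close>)
  also have "\<dots> = 2 * a\<^sup>2 * (H1_norm \<Omega> v)\<^sup>2 + 2 * b\<^sup>2 * (H1_norm \<Omega> w)\<^sup>2"
    using int by (simp add: H1_norm_sq[OF assms(1) v] H1_norm_sq[OF assms(1) w])
  finally show ?thesis .
qed

lemma test_functions_subset_H1:
  assumes "open \<Omega>" "\<phi> \<in> test_functions \<Omega>"
  shows "\<phi> \<in> H1 \<Omega>"
proof -
  have "\<Omega> \<in> sets lebesgue" using assms(1) by auto
  then show ?thesis
    using test_function_L2(1) test_function_weak_grad assms(2) unfolding H1_def by blast
qed

lemma Ck_lincomb: "Ck k v \<Longrightarrow> Ck k w \<Longrightarrow> Ck k (\<lambda>x. a * v x + b * w x)"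
proof (induction k arbitrary: v w)
  case 0
  then show ?case by (auto intro!: continuous_intros)
next
  case (Suc k)
  have "partial_deriv i (\<lambda>x. a * v x + b * w x) = (\<lambda>x. a * partial_deriv i v x + b * partial_deriv i w x)" for i
  proof
    fix x
    have "(v has_derivative frechet_derivative v (at x)) (at x)"
         "(w has_derivative frechet_derivative w (at x)) (at x)"
      using Suc.prems by (auto simp: frechet_derivative_works)
    from partial_deriv_eqI[OF has_derivative_add[OF this[THEN has_derivative_mult_right]]]
    show "partial_deriv i (\<lambda>x. a * v x + b * w x) x = a * partial_deriv i v x + b * partial_deriv i w x"
      by (simp add: partial_deriv_def)
  qed
  then show ?case using Suc by auto
qed

lemma test_functions_lincomb:
  assumes "v \<in> test_functions \<Omega>" "w \<in> test_functions \<Omega>"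
  shows "(\<lambda>x. a * v x + b * w x) \<in> test_functions \<Omega>"
proof -
  let ?S = "closure {x. v x \<noteq> 0} \<union> closure {x. w x \<noteq> 0}"
  have "{x. a * v x + b * w x \<noteq> 0} \<subseteq> {x. v x \<noteq> 0} \<union> {x. w x \<noteq> 0}"
    by (rule subsetI) (auto simp only: mem_Collect_eq Un_iff mult_zero_right add_0_left)
  then have sub: "closure {x. a * v x + b * w x \<noteq> 0} \<subseteq> ?S"
    unfolding closure_Un[symmetric] by (rule closure_mono)
  have S: "compact ?S" "?S \<subseteq> \<Omega>"
    by (intro compact_Un Un_least test_functionD(4,5)[OF assms(1)] test_functionD(4,5)[OF assms(2)])+
  have "compact (closure {x. a * v x + b * w x \<noteq> 0})"
    using compact_Int_closed[OF S(1) closed_closure, of "{x. a * v x + b * w x \<noteq> 0}"]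
    unfolding Int_absorb1[OF sub] .
  then show ?thesis
    using assms Ck_lincomb order_trans[OF sub S(2)] unfolding test_functions_def by blast
qed

lemma H10_D:
  assumes "open \<Omega>" "w \<in> H10 \<Omega>"
  shows "w \<in> L2 \<Omega>" "w \<in> H1 \<Omega>"
  using assms by (auto simp: H10_def H1_def)

lemma H10_lincomb:
  fixes v w :: "'n::finite fn"
  assumes \<Omega>: "open \<Omega>" and v: "v \<in> H10 \<Omega>" and w: "w \<in> H10 \<Omega>"
  shows "(\<lambda>x. a * v x + b * w x) \<in> H10 \<Omega>"
proof -
  obtain \<phi> where \<phi>: "\<And>k. \<phi> k \<in> test_functions \<Omega>" "(\<lambda>k. H1_norm \<Omega> (\<lambda>x. v x - \<phi> k x)) \<longlonglongrightarrow> 0"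
    using v by (auto simp: H10_def)
  obtain \<psi> where \<psi>: "\<And>k. \<psi> k \<in> test_functions \<Omega>" "(\<lambda>k. H1_norm \<Omega> (\<lambda>x. w x - \<psi> k x)) \<longlonglongrightarrow> 0"
    using w by (auto simp: H10_def)
  let ?\<zeta> = "\<lambda>k x. a * \<phi> k x + b * \<psi> k x"
  let ?d = "\<lambda>k. H1_norm \<Omega> (\<lambda>x. (a * v x + b * w x) - ?\<zeta> k x)"
  have bound: "(?d k)\<^sup>2 \<le> 2 * a\<^sup>2 * (H1_norm \<Omega> (\<lambda>x. v x - \<phi> k x))\<^sup>2 + 2 * b\<^sup>2 * (H1_norm \<Omega> (\<lambda>x. w x - \<psi> k x))\<^sup>2" for k
  proof -
    have "(\<lambda>x. 1 * v x + (- 1) * \<phi> k x) \<in> H1 \<Omega>" "(\<lambda>x. 1 * w x + (- 1) * \<psi> k x) \<in> H1 \<Omega>"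
      by (intro H1_lincomb[OF \<Omega>] test_functions_subset_H1[OF \<Omega>] \<phi>(1) \<psi>(1) H10_D(2)[OF \<Omega>] v w)+
    from H1_norm_lincomb[OF \<Omega> this, of a b] show ?thesis by (simp add: algebra_simps)
  qed
  have "(\<lambda>k. (?d k)\<^sup>2) \<longlonglongrightarrow> 0"
  proof (rule tendsto_sandwich[OF _ _ tendsto_const])
    show "(\<lambda>k. 2 * a\<^sup>2 * (H1_norm \<Omega> (\<lambda>x. v x - \<phi> k x))\<^sup>2 + 2 * b\<^sup>2 * (H1_norm \<Omega> (\<lambda>x. w x - \<psi> k x))\<^sup>2) \<longlonglongrightarrow> 0"
      using \<phi>(2) \<psi>(2) by (auto intro!: tendsto_eq_intros)
  qed (use bound in auto)
  then have "?d \<longlonglongrightarrow> 0" using tendsto_real_sqrt[of "\<lambda>k. (?d k)\<^sup>2" 0 sequentially]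
    by (simp add: tendsto_rabs_zero_iff)
  moreover have "\<forall>k. ?\<zeta> k \<in> test_functions \<Omega>"
    by (intro allI test_functions_lincomb \<phi>(1) \<psi>(1))
  ultimately have "\<exists>\<zeta>. (\<forall>k. \<zeta> k \<in> test_functions \<Omega>) \<and>
      (\<lambda>k. H1_norm \<Omega> (\<lambda>x. (a * v x + b * w x) - \<zeta> k x)) \<longlonglongrightarrow> 0"
    by (intro exI[of _ ?\<zeta>] conjI)
  moreover have "(\<lambda>x. a * v x + b * w x) \<in> H1 \<Omega>"
    by (intro H1_lincomb[OF \<Omega>] H10_D(2)[OF \<Omega>] v w)
  ultimately show ?thesis unfolding H10_def by (intro CollectI conjI)
qed

lemma test_functions_subset_H10:
  assumes "open \<Omega>" "\<phi> \<in> test_functions \<Omega>"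
  shows "\<phi> \<in> H10 \<Omega>"
proof -
  have \<phi>: "\<phi> \<in> H1 \<Omega>" using assms by (rule test_functions_subset_H1)
  have "(H1_norm \<Omega> (\<lambda>x. 0 * \<phi> x + 0 * \<phi> x))\<^sup>2 \<le> 0"
    using H1_norm_lincomb[OF assms(1) \<phi> \<phi>, of 0 0] by simp
  then have "(\<lambda>k::nat. H1_norm \<Omega> (\<lambda>x. \<phi> x - \<phi> x)) \<longlonglongrightarrow> 0" by simp
  then have "\<exists>\<psi>. (\<forall>k. \<psi> k \<in> test_functions \<Omega>) \<and> (\<lambda>k. H1_norm \<Omega> (\<lambda>x. \<phi> x - \<psi> k x)) \<longlonglongrightarrow> 0"
    using assms(2) by (intro exI[of _ "\<lambda>_. \<phi>"] conjI allI)
  then show ?thesis using \<phi> unfolding H10_def by (intro CollectI conjI)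
qed

text \<open>
  A form of the Cauchy--Schwarz inequality without square roots or the case distinction on whether \<open>g\<close>
  vanishes. It is the non-negativity of the norm of \<open>d - \<langle>g, d\<rangle> c g\<close> with \<open>c = 1 / (1 + \<langle>g, g\<rangle>)\<close>.
\<close>

lemma pairing_sq_le:
  assumes "g \<in> L2 \<Omega>" "d \<in> L2 \<Omega>"
  shows "(pairing \<Omega> g d)\<^sup>2 \<le> (1 + pairing \<Omega> g g) * pairing \<Omega> d d"
proof -
  let ?A = "pairing \<Omega> g g" and ?B = "pairing \<Omega> g d" and ?D = "pairing \<Omega> d d"
  define c where "c = 1 / (1 + ?A)"
  have A: "0 \<le> ?A" by (auto simp: pairing_def intro!: Bochner_Integration.integral_nonneg)
  have "0 \<le> pairing \<Omega> (\<lambda>x. (- ?B * c) * g x + 1 * d x) (\<lambda>x. (- ?B * c) * g x + 1 * d x)"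
    by (auto simp: pairing_def intro!: Bochner_Integration.integral_nonneg)
  also have "\<dots> = ?B\<^sup>2 * (c * c * ?A) - 2 * c * ?B\<^sup>2 + ?D"
    by (simp only: pairing_lincomb_left pairing_lincomb_right L2_lincomb assms pairing_commute[of _ d g])
       (simp add: power2_eq_square algebra_simps)
  finally have "2 * c * ?B\<^sup>2 \<le> ?B\<^sup>2 * (c * c * ?A) + ?D" by simp
  moreover have "c * ?A \<le> 1" "0 \<le> c"
    using A by (auto simp: c_def divide_simps)
  then have "c * (c * ?A) \<le> c * 1" by (intro mult_left_mono)
  then have "?B\<^sup>2 * (c * c * ?A) \<le> ?B\<^sup>2 * c" by (intro mult_left_mono) auto
  ultimately have "?B\<^sup>2 * c \<le> ?D" by (simp add: mult.commute)
  then show ?thesis using A by (simp add: c_def divide_simps mult.commute split: if_splits)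
qed

text \<open>
  One sequence of test functions serves for all \<open>g\<close>, so equations between pairings extend from test functions,
  which are bounded, to all of \<open>H\<^sub>0\<^sup>1\<close>.
\<close>

lemma H10_approx_pairing:
  fixes w :: "'n::finite fn"
  assumes \<Omega>: "open \<Omega>" and w: "w \<in> H10 \<Omega>"
  obtains \<phi> where "\<And>k. \<phi> k \<in> test_functions \<Omega>"
    and "\<And>g. g \<in> L2 \<Omega> \<Longrightarrow> (\<lambda>k. pairing \<Omega> g (\<phi> k)) \<longlonglongrightarrow> pairing \<Omega> g w"
proof -
  obtain \<phi> where \<phi>: "\<And>k. \<phi> k \<in> test_functions \<Omega>" "(\<lambda>k. H1_norm \<Omega> (\<lambda>x. w x - \<phi> k x)) \<longlonglongrightarrow> 0"
    using w by (auto simp: H10_def)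
  show thesis
  proof (rule that[OF \<phi>(1)])
    fix g assume g: "g \<in> L2 \<Omega>"
    let ?d = "\<lambda>k x. 1 * w x + (- 1) * \<phi> k x"
    have \<phi>H: "\<phi> k \<in> H1 \<Omega>" for k using test_functions_subset_H1[OF \<Omega> \<phi>(1)] .
    have d: "?d k \<in> H1 \<Omega>" for k using H1_lincomb[OF \<Omega> H10_D(2)[OF \<Omega> w] \<phi>H] .
    then have dL2: "?d k \<in> L2 \<Omega>" for k by (simp add: H1_def)
    have "pairing \<Omega> (?d k) (?d k) \<le> (H1_norm \<Omega> (?d k))\<^sup>2" for k
      unfolding H1_norm_sq[OF \<Omega> dL2 weak_grad_works[OF d]] pairing_def
      using L2_integrable_mult[OF dL2 dL2, of k k] integrable_grad_sq[OF weak_grad_works[OF d], of k]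
      by (intro integral_mono) (auto simp: power2_eq_square)
    moreover have "(pairing \<Omega> g (?d k))\<^sup>2 \<le> (1 + pairing \<Omega> g g) * pairing \<Omega> (?d k) (?d k)" for k
      using pairing_sq_le[OF g dL2] .
    moreover have "0 \<le> 1 + pairing \<Omega> g g"
      by (auto simp: pairing_def intro!: add_nonneg_nonneg Bochner_Integration.integral_nonneg)
    ultimately have bound: "(pairing \<Omega> g (?d k))\<^sup>2 \<le> (1 + pairing \<Omega> g g) * (H1_norm \<Omega> (?d k))\<^sup>2" for k
      by (meson mult_left_mono order_trans)
    have "(\<lambda>k. (pairing \<Omega> g (?d k))\<^sup>2) \<longlonglongrightarrow> 0"
    proof (rule tendsto_sandwich[OF _ _ tendsto_const])
      show "(\<lambda>k. (1 + pairing \<Omega> g g) * (H1_norm \<Omega> (?d k))\<^sup>2) \<longlonglongrightarrow> 0"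
        using \<phi>(2) by (auto intro!: tendsto_eq_intros)
    qed (use bound in auto)
    then have "(\<lambda>k. pairing \<Omega> g (?d k)) \<longlonglongrightarrow> 0"
      using tendsto_real_sqrt[of "\<lambda>k. (pairing \<Omega> g (?d k))\<^sup>2" 0 sequentially]
      by (simp add: tendsto_rabs_zero_iff)
    moreover have "pairing \<Omega> g (\<phi> k) = pairing \<Omega> g w - pairing \<Omega> g (?d k)" for k
      using pairing_lincomb_right[OF g H10_D(1)[OF \<Omega> w], of "\<phi> k" 1 "-1"] \<phi>H[of k]
      by (simp add: H1_def)
    ultimately show "(\<lambda>k. pairing \<Omega> g (\<phi> k)) \<longlonglongrightarrow> pairing \<Omega> g w"
      using tendsto_diff[OF tendsto_const, of "\<lambda>k. pairing \<Omega> g (?d k)" 0 sequentially "pairing \<Omega> g w"]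
      by simp
  qed
qed

section \<open>Pointwise estimates with the Green's function\<close>

lemma pairing_le_L1_Linf:
  assumes "w \<in> borel_measurable (lebesgue_on \<Omega>)"
  shows "ennreal \<bar>pairing \<Omega> w v\<bar> \<le> L1_norm \<Omega> w * Linf_norm \<Omega> v"
proof (cases "integrable (lebesgue_on \<Omega>) (\<lambda>x. w x * v x)")
  case True
  have "ennreal \<bar>pairing \<Omega> w v\<bar> \<le> (\<integral>\<^sup>+x. ennreal (norm (w x * v x)) \<partial>lebesgue_on \<Omega>)"
    unfolding pairing_def real_norm_def[symmetric] by (rule integral_norm_bound_ennreal[OF True])
  also have "\<dots> \<le> (\<integral>\<^sup>+x. ennreal \<bar>w x\<bar> * Linf_norm \<Omega> v \<partial>lebesgue_on \<Omega>)"
  proof (rule nn_integral_mono_AE)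
    have "AE x in lebesgue_on \<Omega>. ennreal \<bar>v x\<bar> \<le> Linf_norm \<Omega> v"
      unfolding Linf_norm_def by (rule esssup_AE)
    then show "AE x in lebesgue_on \<Omega>. ennreal (norm (w x * v x)) \<le> ennreal \<bar>w x\<bar> * Linf_norm \<Omega> v"
      by eventually_elim (simp add: abs_mult ennreal_mult mult_left_mono)
  qed
  also have "\<dots> = L1_norm \<Omega> w * Linf_norm \<Omega> v"
    using assms unfolding L1_norm_def by (intro nn_integral_multc) auto
  finally show ?thesis .
qed (simp add: pairing_def not_integrable_integral_eq)

lemma pairing_eq_0_if_L1_norm_eq_0:
  assumes "w \<in> borel_measurable (lebesgue_on \<Omega>)" and "L1_norm \<Omega> w = 0"
  shows "pairing \<Omega> w v = 0"
  using pairing_le_L1_Linf[OF assms(1), of v] assms(2) by simp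

lemma test_functions_subset_Linf:
  fixes \<phi> :: "'n::finite fn"
  assumes "\<Omega> \<in> sets lebesgue" "\<phi> \<in> test_functions \<Omega>"
  shows "\<phi> \<in> Linf \<Omega>"
proof -
  let ?K = "closure {x. \<phi> x \<noteq> 0}"
  have "bounded (\<phi> ` ?K)"
    by (intro compact_imp_bounded compact_continuous_image test_functionD(4)[OF assms(2)]
        continuous_on_subset[OF test_functionD(2)[OF assms(2)]]) auto
  then obtain B where B: "\<And>x. x \<in> ?K \<Longrightarrow> \<bar>\<phi> x\<bar> \<le> B"
    unfolding bounded_iff by auto
  have "\<bar>\<phi> x\<bar> \<le> max B 0" for x
  proof (cases "x \<in> ?K")
    case True
    then show ?thesis using B[OF True] by linarith
  next
    case False
    then have "\<phi> x = 0" by (rule test_functionD(6)[OF assms(2)])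
    then show ?thesis by simp
  qed
  moreover have m: "\<phi> \<in> borel_measurable (lebesgue_on \<Omega>)"
    using test_function_L2(1)[OF assms] by (simp add: L2_def)
  ultimately have "Linf_norm \<Omega> \<phi> \<le> ennreal (max B 0)"
    unfolding Linf_norm_def by (intro esssup_I AE_I2 ennreal_leI) auto
  also have "\<dots> < \<infinity>" by simp
  finally show ?thesis using m by (simp add: Linf_def)
qed

lemma greens_functionD:
  assumes "greens_function \<Omega> L x g" and "r > 0"
  shows "g r \<in> H10 \<Omega>" and "g r \<in> L1 \<Omega>"
    and "v \<in> H10 \<Omega> \<Longrightarrow> ((\<lambda>s. pairing \<Omega> (g s) v) has_real_derivative - L v (g r)) (at r)"
  using assms by (auto simp: greens_function_def adjoint_op_def)

text \<open>
  Against \<open>\<G>(r)\<close> the operator is minus a time derivative of a pairing, and both operations are linear.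
\<close>

lemma greens_function_op_lincomb:
  fixes v w :: "'n::finite fn"
  assumes \<Omega>: "open \<Omega>" and g: "greens_function \<Omega> L x g" and r: "r > 0"
    and v: "v \<in> H10 \<Omega>" and w: "w \<in> H10 \<Omega>"
  shows "L (\<lambda>x. a * v x + b * w x) (g r) = a * L v (g r) + b * L w (g r)"
proof -
  have "((\<lambda>s. a * pairing \<Omega> (g s) v + b * pairing \<Omega> (g s) w) has_real_derivative
      a * (- L v (g r)) + b * (- L w (g r))) (at r)"
    by (intro DERIV_add DERIV_cmult greens_functionD(3)[OF g r] v w)
  then have "((\<lambda>s. pairing \<Omega> (g s) (\<lambda>x. a * v x + b * w x)) has_real_derivative
      a * (- L v (g r)) + b * (- L w (g r))) (at r)"
  proof (rule has_field_derivative_transform_within_open[where S = "{0<..}"])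
    fix s :: real assume "s \<in> {0<..}"
    then show "a * pairing \<Omega> (g s) v + b * pairing \<Omega> (g s) w = pairing \<Omega> (g s) (\<lambda>x. a * v x + b * w x)"
      by (intro pairing_lincomb_right[symmetric] H10_D(1)[OF \<Omega>] greens_functionD(1)[OF g] v w) auto
  qed (use r in auto)
  from DERIV_unique[OF this greens_functionD(3)[OF g r H10_lincomb[OF \<Omega> v w]]]
  show ?thesis by simp
qed

lemma greens_function_op_eq_0_if_stationary:
  assumes g: "greens_function \<Omega> L x g" and r: "r \<in> {0<..<T}" and v: "v \<in> H10 \<Omega>"
    and const: "\<And>s. s \<in> {0<..<T} \<Longrightarrow> pairing \<Omega> (g s) v = c"
  shows "L v (g r) = 0"
proof -
  have "((\<lambda>s. c) has_real_derivative 0) (at r)" by simp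
  then have "((\<lambda>s. pairing \<Omega> (g s) v) has_real_derivative 0) (at r)"
    by (rule has_field_derivative_transform_within_open[where S = "{0<..<T}"]) (use r const in auto)
  from DERIV_unique[OF this greens_functionD(3)[OF g _ v]] r show ?thesis by simp
qed

text \<open>
  If \<open>\<partial>\<^sub>t\<G> = 0\<close>, pairings of \<open>\<G>\<close> with test functions are constant in time. By density so are the pairings with
  any \<open>v\<close>, even an unbounded one, which the time derivatives in \<open>L\<^sub>1\<close> could not be tested with.
\<close>

lemma time_derivative_op_eq_0:
  fixes v :: "'n::finite fn"
  assumes \<Omega>: "open \<Omega>" and g: "greens_function \<Omega> L x g" and D: "time_derivatives \<Omega> g D"
    and zero: "\<And>s. s \<in> {0<..<T} \<Longrightarrow> L1_norm \<Omega> (D 1 s) = 0"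
    and r: "r \<in> {0<..<T}" and v: "v \<in> H10 \<Omega>"
  shows "L v (g r) = 0"
proof (rule greens_function_op_eq_0_if_stationary[OF g r v])
  obtain \<phi> where \<phi>: "\<And>k. \<phi> k \<in> test_functions \<Omega>"
    and lim: "\<And>h. h \<in> L2 \<Omega> \<Longrightarrow> (\<lambda>k. pairing \<Omega> h (\<phi> k)) \<longlonglongrightarrow> pairing \<Omega> h v"
    using H10_approx_pairing[OF \<Omega> v] by blast
  have test: "pairing \<Omega> (g s) (\<phi> k) = pairing \<Omega> (g r) (\<phi> k)" if s: "s \<in> {0<..<T}" for s k
  proof -
    have \<phi>k: "\<phi> k \<in> H10 \<Omega> \<inter> Linf \<Omega>"
      using test_functions_subset_H10[OF \<Omega> \<phi>] test_functions_subset_Linf[OF _ \<phi>] \<Omega> by auto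
    have "((\<lambda>s. pairing \<Omega> (g s) (\<phi> k)) has_real_derivative 0) (at q within {0<..<T})"
      if q: "q \<in> {0<..<T}" for q
    proof -
      have "((\<lambda>s. pairing \<Omega> (D 0 s) (\<phi> k)) has_real_derivative pairing \<Omega> (D (Suc 0) q) (\<phi> k)) (at q)"
        using D \<phi>k q unfolding time_derivatives_def by auto
      moreover have "D (Suc 0) q \<in> L1 \<Omega>"
        using D q unfolding time_derivatives_def by auto
      then have "pairing \<Omega> (D (Suc 0) q) (\<phi> k) = 0"
        using zero[OF q] by (intro pairing_eq_0_if_L1_norm_eq_0) (auto simp: L1_def)
      ultimately show ?thesis
        using D unfolding time_derivatives_def by (auto intro: has_field_derivative_at_within)
    qed
    from has_field_derivative_zero_constant[OF _ this]
    obtain c where "\<forall>q\<in>{0<..<T}. pairing \<Omega> (g q) (\<phi> k) = c" by auto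
    then show ?thesis using s r by simp
  qed
  fix s assume s: "s \<in> {0<..<T}"
  have L2: "g s \<in> L2 \<Omega>" "g r \<in> L2 \<Omega>"
    using s r by (auto intro!: H10_D(1)[OF \<Omega>] greens_functionD(1)[OF g])
  have "(\<lambda>k. pairing \<Omega> (g r) (\<phi> k)) \<longlonglongrightarrow> pairing \<Omega> (g s) v"
    using lim[OF L2(1)] test[OF s] by simp
  then show "pairing \<Omega> (g s) v = pairing \<Omega> (g r) v"
    using lim[OF L2(2)] LIMSEQ_unique by blast
qed

text \<open>
  For bounded \<open>v\<close> both descriptions of \<open>\<partial>\<^sub>t\<G>\<close> apply, and \<open>\<L>v\<close> paired with \<open>\<G>\<close> equals \<open>- \<langle>\<partial>\<^sub>t\<G>, v\<rangle>\<close>. For unbounded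
  \<open>v\<close> the right-hand side is infinite unless both constants vanish.
\<close>

lemma op_le_time_derivative_bound:
  fixes v :: "'n::finite fn"
  assumes \<Omega>: "open \<Omega>" and g: "greens_function \<Omega> L x g" and D: "time_derivatives \<Omega> g D"
    and \<kappa>: "\<kappa>1 \<ge> 0" "\<kappa>1' \<ge> 0"
    and bound: "\<And>s. s \<in> {0<..<T} \<Longrightarrow> L1_norm \<Omega> (D 1 s) \<le> ennreal ((\<kappa>1 / s + \<kappa>1') * exp (- \<gamma> * s))"
    and r: "r \<in> {0<..<T}" and v: "v \<in> H10 \<Omega>"
  shows "ennreal \<bar>L v (g r)\<bar> \<le> ennreal ((\<kappa>1 / r + \<kappa>1') * exp (- \<gamma> * r)) * Linf_norm \<Omega> v"
proof (cases "Linf_norm \<Omega> v < \<infinity>")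
  case True
  then have "v \<in> H10 \<Omega> \<inter> Linf \<Omega>"
    using v H10_D(1)[OF \<Omega> v] by (auto simp: L2_def Linf_def)
  then have "((\<lambda>s. pairing \<Omega> (D 0 s) v) has_real_derivative pairing \<Omega> (D (Suc 0) r) v) (at r)"
    using D r unfolding time_derivatives_def by auto
  then have "((\<lambda>s. pairing \<Omega> (g s) v) has_real_derivative pairing \<Omega> (D 1 r) v) (at r)"
    using D by (simp add: time_derivatives_def)
  from DERIV_unique[OF this greens_functionD(3)[OF g _ v]]
  have "\<bar>L v (g r)\<bar> = \<bar>pairing \<Omega> (D 1 r) v\<bar>" using r by auto
  moreover have "D 1 r \<in> L1 \<Omega>" using D r unfolding time_derivatives_def by auto
  then have "D 1 r \<in> borel_measurable (lebesgue_on \<Omega>)" by (simp add: L1_def)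
  ultimately have "ennreal \<bar>L v (g r)\<bar> \<le> L1_norm \<Omega> (D 1 r) * Linf_norm \<Omega> v"
    using pairing_le_L1_Linf by metis
  also have "\<dots> \<le> ennreal ((\<kappa>1 / r + \<kappa>1') * exp (- \<gamma> * r)) * Linf_norm \<Omega> v"
    by (intro mult_right_mono bound r) simp
  finally show ?thesis .
next
  case False
  show ?thesis
  proof (cases "\<kappa>1 = 0 \<and> \<kappa>1' = 0")
    case True
    then have "L1_norm \<Omega> (D 1 s) = 0" if "s \<in> {0<..<T}" for s
      using bound[OF that] by simp
    from time_derivative_op_eq_0[OF \<Omega> g D this r v] show ?thesis by simp
  next
    case pos: False
    have "\<kappa>1 / r + \<kappa>1' > 0"
      using pos \<kappa> r by (cases "\<kappa>1 = 0") (auto intro!: add_pos_nonneg)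
    then have "ennreal ((\<kappa>1 / r + \<kappa>1') * exp (- \<gamma> * r)) \<noteq> 0"
      using r by (auto simp: ennreal_eq_0_iff not_le)
    then show ?thesis using False by (simp add: not_less top_unique)
  qed
qed

text \<open>
  The infimum over representing functions is infinite if there is none. The product with \<open>c = 0\<close> is then 0,
  whence the last hypothesis.
\<close>

lemma functional_le_Linf_norm:
  fixes w :: "'n::finite fn"
  assumes w: "w \<in> H10 \<Omega> \<inter> L1 \<Omega>" and c: "c \<ge> 0" "L1_norm \<Omega> w \<le> ennreal c"
    and zero: "c = 0 \<Longrightarrow> F w = 0"
  shows "ennreal \<bar>F w\<bar> \<le> ennreal c * Linf_norm_functional \<Omega> F"
proof (cases "c = 0")
  case False
  then have c0: "c > 0" using c by simp
  then have eq: "ennreal \<bar>F w\<bar> = ennreal c * ennreal (\<bar>F w\<bar> / c)"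
    by (simp flip: ennreal_mult)
  have iff: "ennreal c * a \<le> ennreal c * b \<longleftrightarrow> a \<le> b" for a b
    using c0 by (intro ennreal_mult_le_mult_iff) auto
  have "ennreal (\<bar>F w\<bar> / c) \<le> Linf_norm_functional \<Omega> F"
    unfolding Linf_norm_functional_def
  proof (rule INF_greatest)
    fix h assume h: "h \<in> {h \<in> Linf \<Omega>. \<forall>v\<in>H10 \<Omega> \<inter> L1 \<Omega>. F v = pairing \<Omega> h v}"
    then have "ennreal \<bar>F w\<bar> = ennreal \<bar>pairing \<Omega> w h\<bar>" using w by (auto simp: pairing_commute)
    also have "\<dots> \<le> L1_norm \<Omega> w * Linf_norm \<Omega> h"
      using w by (intro pairing_le_L1_Linf) (auto simp: L1_def)
    also have "\<dots> \<le> ennreal c * Linf_norm \<Omega> h" using c(2) by (intro mult_right_mono) auto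
    finally show "ennreal (\<bar>F w\<bar> / c) \<le> Linf_norm \<Omega> h" unfolding eq iff .
  qed
  then show ?thesis unfolding eq iff .
qed (use zero in simp)

lemma op_le_functional_bound:
  fixes v :: "'n::finite fn"
  assumes \<Omega>: "open \<Omega>" and g: "greens_function \<Omega> L x g" and \<kappa>: "\<kappa>0 \<ge> 0"
    and bound: "\<And>s. s \<in> {0<..<T} \<Longrightarrow> L1_norm \<Omega> (g s) \<le> ennreal (\<kappa>0 * exp (- \<gamma> * s))"
    and r: "r \<in> {0<..<T}" and v: "v \<in> H10 \<Omega>"
    and F: "F (g r) = L v (g r)"
  shows "ennreal \<bar>L v (g r)\<bar> \<le> ennreal (\<kappa>0 * exp (- \<gamma> * r)) * Linf_norm_functional \<Omega> F"
  unfolding F[symmetric]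
proof (rule functional_le_Linf_norm[OF _ _ bound[OF r]])
  show "g r \<in> H10 \<Omega> \<inter> L1 \<Omega>" using r greens_functionD[OF g] by auto
  assume "\<kappa>0 * exp (- \<gamma> * r) = 0"
  then have "\<kappa>0 = 0" by simp
  then have "pairing \<Omega> (g s) v = 0" if "s \<in> {0<..<T}" for s
    using bound[OF that] that greens_functionD(2)[OF g]
    by (intro pairing_eq_0_if_L1_norm_eq_0) (auto simp: L1_def)
  from greens_function_op_eq_0_if_stationary[OF g r v this] F show "F (g r) = 0" by simp
qed (use \<kappa> in simp)

text \<open>
  A derivative is a pointwise limit of difference quotients, which here are continuous in time. This is what
  permits splitting the integrated residual into its two terms.
\<close>

lemma greens_function_op_measurable:
  assumes g: "greens_function \<Omega> L x g" and v: "v \<in> H10 \<Omega>" and b: "b \<le> T"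
  shows "(\<lambda>s. L v (g (T - s))) \<in> borel_measurable (lebesgue_on {a<..<b})"
proof -
  let ?p = "\<lambda>r. pairing \<Omega> (g r) v"
  let ?q = "\<lambda>k s. real (Suc k) * (?p (T - s) - ?p (T - s + 1 / real (Suc k)))"
  have cont: "continuous_on {0<..} ?p"
    using DERIV_isCont[OF greens_functionD(3)[OF g _ v]]
    by (intro continuous_at_imp_continuous_on) auto
  show ?thesis
  proof (rule borel_measurable_LIMSEQ_real)
    fix k
    have "continuous_on {a<..<b} (?q k)"
      using b by (intro continuous_intros continuous_on_compose2[OF cont]) (auto simp: add_pos_pos)
    then show "?q k \<in> borel_measurable (lebesgue_on {a<..<b})"
      by (rule continuous_imp_measurable_on_sets_lebesgue) auto
  next
    fix s assume "s \<in> space (lebesgue_on {a<..<b})"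
    then have "T - s > 0" using b by auto
    from greens_functionD(3)[OF g this v]
    have "((\<lambda>h. (?p (T - s + h) - ?p (T - s)) / h) \<longlongrightarrow> - L v (g (T - s))) (at 0)"
      by (simp add: DERIV_def)
    moreover have "filterlim (\<lambda>k. 1 / real (Suc k)) (at 0) sequentially"
      unfolding filterlim_at using LIMSEQ_Suc[OF lim_1_over_n[where 'a = real]] by simp
    ultimately have "(\<lambda>k. (?p (T - s + 1 / real (Suc k)) - ?p (T - s)) / (1 / real (Suc k)))
        \<longlonglongrightarrow> - L v (g (T - s))"
      by (rule filterlim_compose)
    from tendsto_minus[OF this] show "(\<lambda>k. ?q k s) \<longlonglongrightarrow> L v (g (T - s))"
      by (simp add: algebra_simps)
  qed
qed

section \<open>Adding piecewise constant functions of time\<close>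

lemma H10_add_sum_list:
  fixes \<sigma> :: "(real set \<times> 'n::finite fn) list"
  assumes \<Omega>: "open \<Omega>" and "simple_H10 \<Omega> \<sigma>" and w: "w \<in> H10 \<Omega>"
  shows "(\<lambda>x. w x + (\<Sum>(S, y)\<leftarrow>\<sigma>. c S * y x)) \<in> H10 \<Omega>"
  using assms(2)
proof (induction \<sigma>)
  case Nil
  then show ?case using w by simp
next
  case (Cons p \<sigma>)
  obtain S y where p: "p = (S, y)" by force
  have "(\<lambda>x. 1 * (w x + (\<Sum>(S, y)\<leftarrow>\<sigma>. c S * y x)) + c S * y x) \<in> H10 \<Omega>"
    using Cons p by (intro H10_lincomb[OF \<Omega>]) (auto simp: simple_H10_def)
  then show ?case by (simp add: p algebra_simps)
qed

text \<open>
  Appending the given simple function to the approximating ones leaves all differences unchanged.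
\<close>

lemma has_bochner_integral_H10_add_simple:
  fixes F :: "real \<Rightarrow> 'n::finite fn"
  assumes \<Omega>: "open \<Omega>" and F: "has_bochner_integral_H10 \<Omega> a b F I" and \<tau>: "simple_H10 \<Omega> \<tau>"
  shows "has_bochner_integral_H10 \<Omega> a b (\<lambda>s x. F s x + simple_eval \<tau> s x)
           (\<lambda>x. I x + simple_integral_on a b \<tau> x)"
proof -
  obtain \<sigma> where \<sigma>: "\<forall>k. simple_H10 \<Omega> (\<sigma> k)"
      "\<forall>k. (\<lambda>s. H1_norm \<Omega> (\<lambda>x. F s x - simple_eval (\<sigma> k) s x)) \<in> borel_measurable (lebesgue_on {a..b})"
      "(\<lambda>k. \<integral>\<^sup>+s. ennreal (H1_norm \<Omega> (\<lambda>x. F s x - simple_eval (\<sigma> k) s x)) \<partial>lebesgue_on {a..b}) \<longlonglongrightarrow> 0"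
      "(\<lambda>k. H1_norm \<Omega> (\<lambda>x. I x - simple_integral_on a b (\<sigma> k) x)) \<longlonglongrightarrow> 0"
    and I: "I \<in> H10 \<Omega>" and ae: "AE s in lebesgue_on {a..b}. F s \<in> H10 \<Omega>"
    using F unfolding has_bochner_integral_H10_def by blast
  have eval: "F s x + simple_eval \<tau> s x - simple_eval (\<sigma> k @ \<tau>) s x = F s x - simple_eval (\<sigma> k) s x" for s x k
    by (simp add: simple_eval_def)
  have integral: "I x + simple_integral_on a b \<tau> x - simple_integral_on a b (\<sigma> k @ \<tau>) x
      = I x - simple_integral_on a b (\<sigma> k) x" for x k
    by (simp add: simple_integral_on_def)
  show ?thesis
    unfolding has_bochner_integral_H10_def
  proof (intro conjI exI[of _ "\<lambda>k. \<sigma> k @ \<tau>"])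
    show "(\<lambda>x. I x + simple_integral_on a b \<tau> x) \<in> H10 \<Omega>"
      unfolding simple_integral_on_def by (rule H10_add_sum_list[OF \<Omega> \<tau> I])
    show "AE s in lebesgue_on {a..b}. (\<lambda>x. F s x + simple_eval \<tau> s x) \<in> H10 \<Omega>"
      using ae unfolding simple_eval_def by eventually_elim (rule H10_add_sum_list[OF \<Omega> \<tau>])
    show "\<forall>k. simple_H10 \<Omega> (\<sigma> k @ \<tau>)"
      using \<sigma>(1) \<tau> by (auto simp: simple_H10_def)
  qed (use \<sigma> in \<open>simp_all only: eval integral simp_thms\<close>)
qed

text \<open>
  Piecewise linear interpolants have piecewise constant derivatives, so this lemma places the difference of
  the solution and the interpolant in \<open>W\<^sup>1\<^sup>,\<^sup>1\<close>.
\<close>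

lemma W11_H10_add_simple:
  fixes w :: "real \<Rightarrow> 'n::finite fn"
  assumes \<Omega>: "open \<Omega>" and w: "W11_H10 \<Omega> T w w'" and \<tau>: "simple_H10 \<Omega> \<tau>" and c: "c \<in> H10 \<Omega>"
  shows "W11_H10 \<Omega> T (\<lambda>t x. w t x + c x + simple_integral_on 0 t \<tau> x) (\<lambda>s x. w' s x + simple_eval \<tau> s x)"
  unfolding W11_H10_def
proof (intro ballI conjI)
  fix t assume t: "t \<in> {0..T}"
  have "(\<lambda>x. 1 * w t x + 1 * c x) \<in> H10 \<Omega>"
    using w t c unfolding W11_H10_def by (intro H10_lincomb[OF \<Omega>]) auto
  from H10_add_sum_list[OF \<Omega> \<tau> this]
  show "(\<lambda>x. w t x + c x + simple_integral_on 0 t \<tau> x) \<in> H10 \<Omega>"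
    by (simp add: simple_integral_on_def)
  have "(\<Sum>p\<leftarrow>\<tau>. case p of (S, y) \<Rightarrow> measure lborel (S \<inter> {0..0::real}) * y x) = (\<Sum>p\<leftarrow>\<tau>. 0)" for x
  proof (rule arg_cong[where f = sum_list], rule map_cong[OF refl], clarify)
    fix S and y :: "'n fn"
    have "emeasure lborel (S \<inter> {0..0::real}) \<le> emeasure lborel {0..0::real}"
      by (rule emeasure_mono) auto
    then show "measure lborel (S \<inter> {0..0::real}) * y x = 0" by (simp add: measure_def)
  qed
  then have z: "simple_integral_on 0 0 \<tau> x = 0" for x
    by (simp add: simple_integral_on_def)
  show "has_bochner_integral_H10 \<Omega> 0 t (\<lambda>s x. w' s x + simple_eval \<tau> s x)
      (\<lambda>x. w t x + c x + simple_integral_on 0 t \<tau> x - (w 0 x + c x + simple_integral_on 0 0 \<tau> x))"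
    using has_bochner_integral_H10_add_simple[OF \<Omega> _ \<tau>, of 0 t w' "\<lambda>x. w t x - w 0 x"] w t
    by (simp add: z W11_H10_def algebra_simps)
qed

section \<open>The mesh and the piecewise linear interpolant\<close>

lemma mesh_mono:
  assumes "mesh T M t" "i \<le> j" "j \<le> M"
  shows "t i \<le> t j"
  using assms(2,3)
proof (induction j rule: dec_induct)
  case (step n)
  then have "t n < t (Suc n)" using assms(1) by (simp add: mesh_def)
  with step show ?case by simp
qed simp

lemma mesh_bounds:
  assumes "mesh T M t" "j \<in> {1..M}"
  shows "0 \<le> t (j - 1)" and "t (j - 1) < t j" and "t j \<le> T"
proof -
  show "0 \<le> t (j - 1)" "t j \<le> T"
    using mesh_mono[OF assms(1), of 0 "j - 1"] mesh_mono[OF assms(1), of j M] assms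
    by (auto simp: mesh_def)
  have "Suc (j - 1) = j" "j - 1 < M" using assms(2) by auto
  then show "t (j - 1) < t j" using assms(1) unfolding mesh_def by metis
qed

lemma mesh_cover:
  assumes "mesh T M t" "s \<in> {0<..<T}" "s \<notin> t ` {..M}"
  obtains j where "j \<in> {1..M}" "s \<in> {t (j - 1)<..<t j}"
proof -
  define j where "j = (LEAST j. s < t j)"
  have T: "s < t M" using assms by (simp add: mesh_def)
  have j: "s < t j" "j \<le> M"
    unfolding j_def using LeastI[of "\<lambda>j. s < t j", OF T] Least_le[of "\<lambda>j. s < t j", OF T] by auto
  have "j \<noteq> 0" using j assms by (intro notI) (auto simp: mesh_def)
  then have "\<not> s < t (j - 1)"
    unfolding j_def by (intro not_less_Least) (auto simp: j_def)
  moreover have "s \<noteq> t (j - 1)" using assms(3) j(2) by (auto simp: image_iff)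
  ultimately show thesis using that[of j] j \<open>j \<noteq> 0\<close> by auto
qed

lemma measure_cell_Int:
  fixes a b s :: real
  assumes "0 \<le> a" "a \<le> b"
  shows "measure lborel ({a<..<b} \<inter> {0..s}) = (if s \<le> a then 0 else if b \<le> s then b - a else s - a)"
proof -
  consider "s \<le> a" | "a < s" "b \<le> s" | "a < s" "s < b" by linarith
  then show ?thesis
  proof cases
    case 1
    then have "{a<..<b} \<inter> {0..s} = {}" by auto
    then show ?thesis using 1 by simp
  next
    case 2
    then have "{a<..<b} \<inter> {0..s} = {a<..<b}" using assms by auto
    then show ?thesis using 2 assms by simp
  next
    case 3
    then have "{a<..<b} \<inter> {0..s} = {a<..s}" using assms by auto
    then show ?thesis using 3 assms by simp
  qed
qed

text \<open>
  The primitive of the piecewise constant slopes is the interpolant: complete cells telescope, the current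
  cell contributes its linear part.
\<close>

lemma piecewise_linear_interpolant:
  fixes V :: "nat \<Rightarrow> real"
  assumes mesh: "mesh T M t" and i: "i \<in> {1..M}" and s: "t (i - 1) \<le> s" "s \<le> t i"
  shows "(\<Sum>j=1..M. measure lborel ({t (j - 1)<..<t j} \<inter> {0..s}) * ((V j - V (j - 1)) / tau t j))
    = V i - V 0 - (t i - s) * ((V i - V (i - 1)) / tau t i)"
proof -
  let ?m = "\<lambda>j. measure lborel ({t (j - 1)<..<t j} \<inter> {0..s}) * ((V j - V (j - 1)) / tau t j)"
  have tau: "tau t j > 0" if "j \<in> {1..M}" for j
    using mesh_bounds(2)[OF mesh that] by (simp add: tau_def)
  have m: "measure lborel ({t (j - 1)<..<t j} \<inter> {0..s})
      = (if s \<le> t (j - 1) then 0 else if t j \<le> s then tau t j else s - t (j - 1))" if "j \<in> {1..M}" for j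
    using measure_cell_Int[of "t (j - 1)" "t j" s] mesh_bounds[OF mesh that] by (simp add: tau_def)
  have "(\<Sum>j=1..M. ?m j) = (\<Sum>j\<in>{1..<i}. ?m j) + ?m i + (\<Sum>j\<in>{i<..M}. ?m j)"
  proof -
    have "{1..M} = {1..<i} \<union> {i} \<union> {i<..M}" using i by auto
    then show ?thesis by (simp only:) (subst sum.union_disjoint; auto)+
  qed
  also have "(\<Sum>j\<in>{i<..M}. ?m j) = 0"
  proof (rule sum.neutral, rule ballI)
    fix j assume j: "j \<in> {i<..M}"
    then have "t i \<le> t (j - 1)" by (intro mesh_mono[OF mesh]) auto
    then show "?m j = 0" using s j m[of j] i by auto
  qed
  also have "(\<Sum>j\<in>{1..<i}. ?m j) = (\<Sum>j\<in>{1..<i}. V j - V (j - 1))"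
  proof (rule sum.cong[OF refl])
    fix j assume j: "j \<in> {1..<i}"
    then have jM: "j \<in> {1..M}" using i by auto
    have "t j \<le> t (i - 1)" using j i by (intro mesh_mono[OF mesh]) auto
    then have "t j \<le> s" "t (j - 1) < s" using s mesh_bounds(2)[OF mesh jM] by auto
    then show "?m j = V j - V (j - 1)" using tau[OF jM] unfolding m[OF jM] by simp
  qed
  also have "\<dots> = V (i - 1) - V 0"
  proof -
    have "(\<Sum>j\<in>{1..<Suc n}. V j - V (j - 1)) = V n - V 0" for n
      by (induction n) auto
    moreover obtain n where "i = Suc n" using i by (cases i) auto
    ultimately show ?thesis by simp
  qed
  also have "?m i = (V i - V (i - 1)) - (t i - s) * ((V i - V (i - 1)) / tau t i)"
  proof -
    have "measure lborel ({t (i - 1)<..<t i} \<inter> {0..s}) = tau t i - (t i - s)"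
      using m[OF i] s mesh_bounds(2)[OF mesh i] by (auto simp: tau_def)
    moreover have "tau t i * ((V i - V (i - 1)) / tau t i) = V i - V (i - 1)"
      using tau[OF i] by simp
    ultimately show ?thesis by (simp only: left_diff_distrib)
  qed
  finally show ?thesis by simp
qed

section \<open>Integrals in time\<close>

lemma nn_integral_FTC_interior:
  fixes F f :: "real \<Rightarrow> real"
  assumes "a \<le> b" "continuous_on {a..b} F"
    and "\<And>s. s \<in> {a<..<b} \<Longrightarrow> (F has_real_derivative f s) (at s)"
    and "\<And>s. s \<in> {a<..<b} \<Longrightarrow> 0 \<le> f s"
  shows "(\<integral>\<^sup>+s. ennreal (f s) \<partial>lebesgue_on {a<..<b}) = ennreal (F b - F a)"
proof -
  have "(f has_integral (F b - F a)) {a..b}"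
    using assms by (intro fundamental_theorem_of_calculus_interior)
      (auto simp: has_real_derivative_iff_has_vector_derivative)
  then have "(f has_integral (F b - F a)) {a<..<b}" by (simp only: has_integral_Icc_iff_Ioo)
  from nn_integral_has_integral_lebesgue'[OF assms(4) this]
  show ?thesis by (subst nn_integral_restrict_space) (auto simp: nn_integral_completion)
qed

lemma nn_integral_linear_weight:
  fixes a b :: real
  assumes "a \<le> b"
  shows "(\<integral>\<^sup>+s. ennreal (b - s) \<partial>lebesgue_on {a<..<b}) = ennreal ((b - a)\<^sup>2 / 2)"
proof -
  have "(\<integral>\<^sup>+s. ennreal (b - s) \<partial>lebesgue_on {a<..<b}) = ennreal (- (b - b)\<^sup>2 / 2 - (- (b - a)\<^sup>2 / 2))"
    using assms
    by (intro nn_integral_FTC_interior[where F = "\<lambda>s. - (b - s)\<^sup>2 / 2"])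
       (auto intro!: derivative_eq_intros continuous_intros simp: field_simps)
  then show ?thesis by simp
qed

text \<open>
  The weight \<open>b - s\<close> cancels the singularity since \<open>(b - s) / (T - s) = 1 - (T - b) / (T - s)\<close>. For \<open>b = T\<close>
  the logarithm is multiplied by 0, both in the primitive and in the result.
\<close>

lemma nn_integral_singular_weight:
  fixes a b T :: real
  assumes ab: "a < b" "b \<le> T" and \<kappa>: "\<kappa>1 \<ge> 0" "\<kappa>1' \<ge> 0"
  shows "(\<integral>\<^sup>+s. ennreal ((b - s) * (\<kappa>1 / (T - s) + \<kappa>1')) \<partial>lebesgue_on {a<..<b})
    = ennreal (\<kappa>1 * ((b - a) - (T - b) * ln (1 + (b - a) / (T - b))) + \<kappa>1' * (b - a)\<^sup>2 / 2)"
proof -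
  let ?F = "\<lambda>s. \<kappa>1 * (s + (T - b) * ln (T - s)) - \<kappa>1' * ((b - s)\<^sup>2 / 2)"
  have "(\<integral>\<^sup>+s. ennreal ((b - s) * (\<kappa>1 / (T - s) + \<kappa>1')) \<partial>lebesgue_on {a<..<b}) = ennreal (?F b - ?F a)"
  proof (rule nn_integral_FTC_interior)
    show "continuous_on {a..b} ?F"
      using ab by (cases "b = T") (auto intro!: continuous_intros)
    fix s assume s: "s \<in> {a<..<b}"
    then show "0 \<le> (b - s) * (\<kappa>1 / (T - s) + \<kappa>1')" using ab \<kappa> by auto
    have "((\<lambda>s. ln (T - s)) has_real_derivative - 1 / (T - s)) (at s)"
      using s ab by (auto intro!: derivative_eq_intros)
    moreover have "((\<lambda>s. (b - s)\<^sup>2 / 2) has_real_derivative - (b - s)) (at s)"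
      by (auto intro!: derivative_eq_intros)
    ultimately have "(?F has_real_derivative
        \<kappa>1 * (1 + (T - b) * (- 1 / (T - s))) - \<kappa>1' * (- (b - s))) (at s)"
      by (intro DERIV_diff DERIV_cmult DERIV_add DERIV_ident)
    moreover have *: "1 + (T - b) * (- 1 / (T - s)) = (b - s) / (T - s)"
      using s ab by (simp add: field_simps)
    have "\<kappa>1 * (1 + (T - b) * (- 1 / (T - s))) - \<kappa>1' * (- (b - s)) = (b - s) * (\<kappa>1 / (T - s) + \<kappa>1')"
      unfolding * by (simp add: algebra_simps)
    ultimately show "(?F has_real_derivative (b - s) * (\<kappa>1 / (T - s) + \<kappa>1')) (at s)"
      by (simp only:)
  qed (use ab in simp)
  also have "?F b - ?F a = \<kappa>1 * ((b - a) - (T - b) * ln (1 + (b - a) / (T - b))) + \<kappa>1' * (b - a)\<^sup>2 / 2"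
  proof (cases "b = T")
    case False
    then have "ln (1 + (b - a) / (T - b)) = ln ((T - a) / (T - b))"
      using ab by (simp add: field_simps)
    also have "\<dots> = ln (T - a) - ln (T - b)" using ab False by (simp add: ln_div)
    finally have *: "ln (1 + (b - a) / (T - b)) = ln (T - a) - ln (T - b)" .
    show ?thesis unfolding * by (simp add: algebra_simps)
  qed (simp add: algebra_simps)
  finally show ?thesis .
qed

text \<open>
  The majorant \<open>k\<close> may be non-measurable, so the constant cannot be moved out of its integral directly;
  instead the measurable \<open>h\<close> is divided by it.
\<close>

lemma nn_integral_le_cmult:
  assumes h: "h \<in> borel_measurable M" and c: "c \<ge> 0" and le: "AE s in M. h s \<le> ennreal c * k s"
  shows "(\<integral>\<^sup>+s. h s \<partial>M) \<le> ennreal c * (\<integral>\<^sup>+s. k s \<partial>M)"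
proof (cases "c = 0")
  case True
  then have "AE s in M. h s \<le> 0" using le by simp
  then have "(\<integral>\<^sup>+s. h s \<partial>M) \<le> (\<integral>\<^sup>+s. 0 \<partial>M)" by (rule nn_integral_mono_AE)
  then show ?thesis by simp
next
  case False
  let ?h = "\<lambda>s. ennreal (1 / c) * h s"
  have inv: "ennreal c * (ennreal (1 / c) * y) = y" "ennreal (1 / c) * (ennreal c * y) = y" for y
    using False c by (simp_all flip: mult.assoc ennreal_mult)
  have "(\<integral>\<^sup>+s. h s \<partial>M) = (\<integral>\<^sup>+s. ennreal c * ?h s \<partial>M)" by (simp only: inv)
  also have "\<dots> = ennreal c * (\<integral>\<^sup>+s. ?h s \<partial>M)" using h by (intro nn_integral_cmult) auto
  also have "\<dots> \<le> ennreal c * (\<integral>\<^sup>+s. k s \<partial>M)"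
  proof (intro mult_left_mono nn_integral_mono_AE)
    show "AE s in M. ?h s \<le> k s"
      using le
    proof eventually_elim
      case (elim s)
      then have "?h s \<le> ennreal (1 / c) * (ennreal c * k s)" by (intro mult_left_mono) auto
      then show ?case by (simp only: inv)
    qed
  qed simp
  finally show ?thesis .
qed

section \<open>The a posteriori error estimate\<close>

text \<open>
  The second term of the residual is measurable in time, hence so is the first as a difference, and the
  integral of the sum splits. On the cell \<open>T - s \<ge> T - t j\<close>, so the exponential is largest at the right end.
\<close>

lemma cell_residual_estimate:
  fixes U :: "nat \<Rightarrow> 'n::finite fn"
  assumes \<Omega>: "open \<Omega>" and g: "greens_function \<Omega> L x g" and D: "time_derivatives \<Omega> g D"
    and \<gamma>: "\<gamma> \<ge> 0" and \<kappa>: "\<kappa>0 \<ge> 0" "\<kappa>1 \<ge> 0" "\<kappa>1' \<ge> 0"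
    and bound0: "\<And>s. s \<in> {0<..<T} \<Longrightarrow> L1_norm \<Omega> (g s) \<le> ennreal (\<kappa>0 * exp (- \<gamma> * s))"
    and bound1: "\<And>s. s \<in> {0<..<T} \<Longrightarrow> L1_norm \<Omega> (D 1 s) \<le> ennreal ((\<kappa>1 / s + \<kappa>1') * exp (- \<gamma> * s))"
    and mesh: "mesh T M t" and j: "j \<in> {1..M}"
    and U: "U j \<in> H10 \<Omega>" "U (j - 1) \<in> H10 \<Omega>" and f: "\<forall>s\<in>{0..T}. f s \<in> L2 \<Omega>"
    and P: "P \<in> borel_measurable (lebesgue_on {t (j - 1)<..<t j})"
    and P_eq: "AE s in lebesgue_on {t (j - 1)<..<t j}. P s = pairing \<Omega> (\<lambda>x. f s x - f (t j) x) (g (T - s))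
        + (t j - s) * L (diff_quot t U j) (g (T - s))"
  shows "(\<integral>\<^sup>+s. ennreal \<bar>P s\<bar> \<partial>lebesgue_on {t (j - 1)<..<t j})
    \<le> ennreal (exp (- \<gamma> * (T - t j))) * (eta_f \<Omega> \<kappa>0 f t j + eta_min \<Omega> T \<kappa>0 \<kappa>1 \<kappa>1' L t U j)"
proof -
  let ?I = "{t (j - 1)<..<t j}" and ?v = "diff_quot t U j"
  let ?F = "diff_quot t (\<lambda>i. L (U i)) j"
  define M where "M = lebesgue_on ?I"
  define e where "e = exp (- \<gamma> * (T - t j))"
  define B where "B = (\<lambda>s. (t j - s) * L ?v (g (T - s)))"
  note mb = mesh_bounds[OF mesh j]
  have e0: "0 \<le> e" by (simp add: e_def)
  have space: "space M = ?I" by (simp add: M_def)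
  have cont: "h \<in> borel_measurable M" if "continuous_on ?I h" for h :: "real \<Rightarrow> real"
    unfolding M_def using that by (rule continuous_imp_measurable_on_sets_lebesgue) auto
  have r: "T - s \<in> {0<..<T}" if "s \<in> ?I" for s using that mb by auto
  have e: "exp (- \<gamma> * (T - s)) \<le> e" if "s \<in> ?I" for s
    unfolding e_def using that \<gamma> by (auto intro!: mult_left_mono)
  have v: "?v \<in> H10 \<Omega>" and F: "?F (g q) = L ?v (g q)" if q: "q > 0" for q
  proof -
    have eq: "?v = (\<lambda>x. 1 / tau t j * U j x + (- 1 / tau t j) * U (j - 1) x)"
      by (simp add: diff_quot_def diff_divide_distrib)
    show "?v \<in> H10 \<Omega>" unfolding eq by (rule H10_lincomb[OF \<Omega> U])
    show "?F (g q) = L ?v (g q)"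
      unfolding eq greens_function_op_lincomb[OF \<Omega> g q U] by (simp add: diff_quot_def diff_divide_distrib)
  qed
  note v = v[of 1, simplified]
  have B: "B \<in> borel_measurable M"
    unfolding B_def
  proof (rule borel_measurable_times)
    show "(\<lambda>s. t j - s) \<in> borel_measurable M" by (intro cont continuous_intros)
    show "(\<lambda>s. L ?v (g (T - s))) \<in> borel_measurable M"
      unfolding M_def by (rule greens_function_op_measurable[OF g v mb(3)])
  qed
  have PB: "(\<lambda>s. P s - B s) \<in> borel_measurable M"
    using P B by (simp add: M_def)

  have "(\<integral>\<^sup>+s. ennreal \<bar>P s - B s\<bar> \<partial>M)
      \<le> ennreal (\<kappa>0 * e) * (\<integral>\<^sup>+s. Linf_norm \<Omega> (\<lambda>x. f s x - f (t j) x) \<partial>M)"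
  proof (rule nn_integral_le_cmult)
    show "AE s in M. ennreal \<bar>P s - B s\<bar> \<le> ennreal (\<kappa>0 * e) * Linf_norm \<Omega> (\<lambda>x. f s x - f (t j) x)"
      using P_eq[folded M_def] AE_space[of M]
    proof eventually_elim
      case (elim s)
      let ?h = "\<lambda>x. f s x - f (t j) x"
      have s: "s \<in> ?I" using elim(2) unfolding space .
      have "ennreal \<bar>P s - B s\<bar> = ennreal \<bar>pairing \<Omega> (g (T - s)) ?h\<bar>"
        using elim(1) by (simp add: B_def pairing_commute)
      also have "\<dots> \<le> L1_norm \<Omega> (g (T - s)) * Linf_norm \<Omega> ?h"
        using greens_functionD(2)[OF g, of "T - s"] r[OF s]
        by (intro pairing_le_L1_Linf) (auto simp: L1_def)
      also have "\<dots> \<le> ennreal (\<kappa>0 * e) * Linf_norm \<Omega> ?h"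
        using e[OF s] \<kappa>
        by (intro mult_right_mono order_trans[OF bound0[OF r[OF s]]] ennreal_leI mult_left_mono) auto
      finally show ?case .
    qed
  qed (use PB \<kappa> e0 in auto)
  also have "\<dots> = ennreal e * eta_f \<Omega> \<kappa>0 f t j"
    using \<kappa> e0 by (simp add: eta_f_def M_def ennreal_mult mult_ac)
  finally have A: "(\<integral>\<^sup>+s. ennreal \<bar>P s - B s\<bar> \<partial>M) \<le> ennreal e * eta_f \<Omega> \<kappa>0 f t j" .

  have B1: "(\<integral>\<^sup>+s. ennreal \<bar>B s\<bar> \<partial>M) \<le> ennreal e * eta_dU \<Omega> T \<kappa>1 \<kappa>1' t U j"
  proof -
    have "(\<integral>\<^sup>+s. ennreal \<bar>B s\<bar> \<partial>M)
       \<le> (\<integral>\<^sup>+s. ennreal ((t j - s) * (\<kappa>1 / (T - s) + \<kappa>1')) * (ennreal e * Linf_norm \<Omega> ?v) \<partial>M)"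
    proof (rule nn_integral_mono)
      fix s assume "s \<in> space M"
      then have s: "s \<in> ?I" by (simp add: space)
      have "ennreal \<bar>B s\<bar> = ennreal (t j - s) * ennreal \<bar>L ?v (g (T - s))\<bar>"
        using s by (simp add: B_def abs_mult ennreal_mult)
      also have "\<dots> \<le> ennreal (t j - s)
          * (ennreal ((\<kappa>1 / (T - s) + \<kappa>1') * exp (- \<gamma> * (T - s))) * Linf_norm \<Omega> ?v)"
        by (intro mult_left_mono op_le_time_derivative_bound[OF \<Omega> g D \<kappa>(2,3) bound1 r[OF s] v]) auto
      also have "\<dots> \<le> ennreal (t j - s) * (ennreal ((\<kappa>1 / (T - s) + \<kappa>1') * e) * Linf_norm \<Omega> ?v)"
        using e[OF s] \<kappa> r[OF s]
        by (intro mult_left_mono mult_right_mono ennreal_leI) auto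
      also have "\<dots> = ennreal ((t j - s) * (\<kappa>1 / (T - s) + \<kappa>1')) * (ennreal e * Linf_norm \<Omega> ?v)"
        using s \<kappa> r[OF s] e0 by (simp add: ennreal_mult mult_ac)
      finally show "ennreal \<bar>B s\<bar>
          \<le> ennreal ((t j - s) * (\<kappa>1 / (T - s) + \<kappa>1')) * (ennreal e * Linf_norm \<Omega> ?v)" .
    qed
    also have "\<dots> = (\<integral>\<^sup>+s. ennreal ((t j - s) * (\<kappa>1 / (T - s) + \<kappa>1')) \<partial>M) * (ennreal e * Linf_norm \<Omega> ?v)"
    proof (intro nn_integral_multc)
      have "(\<lambda>s. (t j - s) * (\<kappa>1 / (T - s) + \<kappa>1')) \<in> borel_measurable M"
        using mb by (intro cont continuous_intros) auto
      then show "(\<lambda>s. ennreal ((t j - s) * (\<kappa>1 / (T - s) + \<kappa>1'))) \<in> borel_measurable M" by simp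
    qed
    also have "(\<integral>\<^sup>+s. ennreal ((t j - s) * (\<kappa>1 / (T - s) + \<kappa>1')) \<partial>M) = ennreal (rho T \<kappa>1 \<kappa>1' t j)"
      unfolding M_def rho_def tau_def by (rule nn_integral_singular_weight[OF mb(2,3) \<kappa>(2,3)])
    finally show ?thesis by (simp add: eta_dU_def mult_ac)
  qed

  have B2: "(\<integral>\<^sup>+s. ennreal \<bar>B s\<bar> \<partial>M) \<le> ennreal e * eta_dLU \<Omega> \<kappa>0 L t U j"
  proof -
    let ?K = "Linf_norm_functional \<Omega> ?F"
    have "(\<integral>\<^sup>+s. ennreal \<bar>B s\<bar> \<partial>M) \<le> (\<integral>\<^sup>+s. ennreal (t j - s) * (ennreal (\<kappa>0 * e) * ?K) \<partial>M)"
    proof (rule nn_integral_mono)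
      fix s assume "s \<in> space M"
      then have s: "s \<in> ?I" by (simp add: space)
      have "ennreal \<bar>B s\<bar> = ennreal (t j - s) * ennreal \<bar>L ?v (g (T - s))\<bar>"
        using s by (simp add: B_def abs_mult ennreal_mult)
      also have "\<dots> \<le> ennreal (t j - s) * (ennreal (\<kappa>0 * exp (- \<gamma> * (T - s))) * ?K)"
        using r[OF s] F[of "T - s"]
        by (intro mult_left_mono op_le_functional_bound[OF \<Omega> g \<kappa>(1) bound0 r[OF s] v]) auto
      also have "\<dots> \<le> ennreal (t j - s) * (ennreal (\<kappa>0 * e) * ?K)"
        using e[OF s] \<kappa> by (intro mult_left_mono mult_right_mono ennreal_leI) auto
      finally show "ennreal \<bar>B s\<bar> \<le> ennreal (t j - s) * (ennreal (\<kappa>0 * e) * ?K)" .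
    qed
    also have "\<dots> = (\<integral>\<^sup>+s. ennreal (t j - s) \<partial>M) * (ennreal (\<kappa>0 * e) * ?K)"
    proof (intro nn_integral_multc)
      have "(\<lambda>s. t j - s) \<in> borel_measurable M" by (intro cont continuous_intros)
      then show "(\<lambda>s. ennreal (t j - s)) \<in> borel_measurable M" by simp
    qed
    also have "(\<integral>\<^sup>+s. ennreal (t j - s) \<partial>M) = ennreal ((tau t j)\<^sup>2 / 2)"
      unfolding M_def tau_def using mb by (intro nn_integral_linear_weight) auto
    also have "ennreal ((tau t j)\<^sup>2 / 2) * (ennreal (\<kappa>0 * e) * ?K)
        = ennreal e * (ennreal (\<kappa>0 * (tau t j)\<^sup>2 / 2) * ?K)"
    proof -
      have "ennreal ((tau t j)\<^sup>2 / 2) * ennreal (\<kappa>0 * e) = ennreal e * ennreal (\<kappa>0 * (tau t j)\<^sup>2 / 2)"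
        using \<kappa> e0 by (simp add: mult_ac flip: ennreal_mult)
      then show ?thesis by (simp only: mult.assoc[symmetric])
    qed
    finally show ?thesis by (simp add: eta_dLU_def)
  qed

  have "(\<integral>\<^sup>+s. ennreal \<bar>P s\<bar> \<partial>M) \<le> (\<integral>\<^sup>+s. ennreal \<bar>P s - B s\<bar> + ennreal \<bar>B s\<bar> \<partial>M)"
    by (intro nn_integral_mono) (simp flip: ennreal_plus)
  also have "\<dots> = (\<integral>\<^sup>+s. ennreal \<bar>P s - B s\<bar> \<partial>M) + (\<integral>\<^sup>+s. ennreal \<bar>B s\<bar> \<partial>M)"
    using PB B by (intro nn_integral_add) auto
  also have "\<dots> \<le> ennreal e * eta_f \<Omega> \<kappa>0 f t j + ennreal e * eta_min \<Omega> T \<kappa>0 \<kappa>1 \<kappa>1' L t U j"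
    using B1 B2 by (intro add_mono A) (auto simp: eta_min_def min_def)
  finally show ?thesis by (simp add: M_def e_def distrib_left)
qed

lemma nn_integral_mesh_le:
  fixes P :: "real \<Rightarrow> real"
  assumes mesh: "mesh T M t" and P: "P \<in> borel_measurable (lebesgue_on {0<..<T})"
  shows "(\<integral>\<^sup>+s. ennreal \<bar>P s\<bar> \<partial>lebesgue_on {0<..<T})
    \<le> (\<Sum>j=1..M. \<integral>\<^sup>+s. ennreal \<bar>P s\<bar> \<partial>lebesgue_on {t (j - 1)<..<t j})"
proof -
  let ?I = "\<lambda>j. {t (j - 1)<..<t j}"
  have sub: "?I j \<subseteq> {0<..<T}" if "j \<in> {1..M}" for j
    using mesh_bounds[OF mesh that] by auto
  have Pj: "(\<lambda>s. ennreal \<bar>P s\<bar> * indicator (?I j) s) \<in> borel_measurable lebesgue" if "j \<in> {1..M}" for j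
  proof -
    have "(\<lambda>s. ennreal \<bar>P s\<bar>) \<in> borel_measurable (lebesgue_on (?I j))"
      using measurable_restrict_mono[OF P sub[OF that]] by auto
    then show ?thesis by (subst (asm) borel_measurable_restrict_space_iff_ennreal) (auto simp: mult.commute)
  qed
  have "(\<integral>\<^sup>+s. ennreal \<bar>P s\<bar> \<partial>lebesgue_on {0<..<T})
      = (\<integral>\<^sup>+s. ennreal \<bar>P s\<bar> * indicator {0<..<T} s \<partial>lebesgue)"
    by (rule nn_integral_restrict_space) auto
  also have "\<dots> \<le> (\<integral>\<^sup>+s. (\<Sum>j=1..M. ennreal \<bar>P s\<bar> * indicator (?I j) s) \<partial>lebesgue)"
  proof (rule nn_integral_mono_AE)
    have "finite (t ` {..M})" by simp
    then have "AE s in lebesgue. s \<notin> t ` {..M}"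
      by (intro AE_not_in) (simp add: negligible_finite flip: negligible_iff_null_sets)
    then show "AE s in lebesgue. ennreal \<bar>P s\<bar> * indicator {0<..<T} s
        \<le> (\<Sum>j=1..M. ennreal \<bar>P s\<bar> * indicator (?I j) s)"
    proof eventually_elim
      case (elim s)
      show ?case
      proof (cases "s \<in> {0<..<T}")
        case True
        then obtain j where j: "j \<in> {1..M}" "s \<in> ?I j" using mesh_cover[OF mesh _ elim] by metis
        have "ennreal \<bar>P s\<bar> * indicator (?I j) s \<le> (\<Sum>j=1..M. ennreal \<bar>P s\<bar> * indicator (?I j) s)"
          using j by (intro member_le_sum) auto
        then show ?thesis using j True by simp
      qed simp
    qed
  qed
  also have "\<dots> = (\<Sum>j=1..M. \<integral>\<^sup>+s. ennreal \<bar>P s\<bar> * indicator (?I j) s \<partial>lebesgue)"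
    by (rule nn_integral_sum) (rule Pj)
  also have "\<dots> = (\<Sum>j=1..M. \<integral>\<^sup>+s. ennreal \<bar>P s\<bar> \<partial>lebesgue_on (?I j))"
    by (intro sum.cong refl nn_integral_restrict_space[symmetric]) auto
  finally show ?thesis .
qed

theorem theorem3:
  fixes \<Omega> :: "(real^'n) set"
    and T \<gamma> :: real and \<kappa> \<kappa>' :: "nat \<Rightarrow> real"
    and L :: "'n fn \<Rightarrow> 'n fn \<Rightarrow> real"
    and f u :: "real \<Rightarrow> 'n fn" and u0 :: "'n fn"
    and G :: "real^'n \<Rightarrow> real \<Rightarrow> 'n fn"
    and DG :: "real^'n \<Rightarrow> nat \<Rightarrow> real \<Rightarrow> 'n fn"
    and M :: nat and t :: "nat \<Rightarrow> real" and U :: "nat \<Rightarrow> 'n fn"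
  assumes "lipschitz_domain \<Omega>" and "T > 0" and "second_order_elliptic \<Omega> L"
    and "\<forall>s\<in>{0..T}. f s \<in> L2 \<Omega>"
    and "parabolic_solution \<Omega> T L f u0 u"
    and "\<forall>x\<in>\<Omega>. greens_function \<Omega> L x (G x)"
    and "greens_representation \<Omega> T L G"
    and "\<forall>x\<in>\<Omega>. time_derivatives \<Omega> (G x) (DG x)"
    and "\<gamma> \<ge> 0" and "\<forall>p\<le>2. \<kappa> p \<ge> 0 \<and> \<kappa>' p \<ge> 0" and "\<kappa>' 0 = 0"
    and "\<forall>x\<in>\<Omega>. \<forall>s\<in>{0<..T}. \<forall>p\<le>2.
           L1_norm \<Omega> (DG x p s) \<le> ennreal ((\<kappa> p / s ^ p + \<kappa>' p) * exp (- \<gamma> * s))"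
    and "mesh T M t"
    and "backward_euler \<Omega> L f u0 M t U"
  shows "Linf_norm \<Omega> (\<lambda>x. u T x - U M x)
           \<le> (\<Sum>j=1..M. ennreal (exp (- \<gamma> * (T - t j))) *
                (eta_f \<Omega> (\<kappa> 0) f t j + eta_min \<Omega> T (\<kappa> 0) (\<kappa> 1) (\<kappa>' 1) L t U j))"
    (is "_ \<le> ?estimate")
proof -
  note T = \<open>T > 0\<close> and f = assms(4) and G = assms(6) and DG = assms(8) and mesh = assms(13)
  note BE = assms(14)[unfolded backward_euler_def]
  have \<Omega>: "open \<Omega>" using assms(1) by (simp add: lipschitz_domain_def)
  obtain u' where u: "W11_H10 \<Omega> T u u'"
    and pde: "AE s in lebesgue_on {0..T}. \<forall>v\<in>H10 \<Omega>. parabolic_op \<Omega> L u u' s v = pairing \<Omega> (f s) v"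
    and u_init: "AE x in lebesgue_on \<Omega>. u 0 x = u0 x"
    using assms(5) by (auto simp: parabolic_solution_def)
  have uH: "u s \<in> H10 \<Omega>" if "s \<in> {0..T}" for s using u that by (simp add: W11_H10_def)
  have u'H: "AE s in lebesgue_on {0..T}. u' s \<in> H10 \<Omega>"
    using u T by (auto simp: W11_H10_def has_bochner_integral_H10_def)
  have UH: "U j \<in> H10 \<Omega>" if "j \<le> M" for j using BE that by blast
  have M: "M \<ge> 1" using mesh T by (cases M) (auto simp: mesh_def)

  define I where "I = (\<lambda>j. {t (j - 1)<..<t j})"
  define \<delta> where "\<delta> = diff_quot t U"
  (* The derivative of minus the interpolant, as a simple function of time. *)
  define \<tau> where "\<tau> = map (\<lambda>j. (I j, \<lambda>x. - \<delta> j x)) [1..<Suc M]"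
  define w where "w = (\<lambda>s x. u s x + (- U 0 x) + simple_integral_on 0 s \<tau> x)"
  define w' where "w' = (\<lambda>s x. u' s x + simple_eval \<tau> s x)"
  have \<delta>H: "\<delta> j \<in> H10 \<Omega>" if "j \<in> {1..M}" for j
  proof -
    have "(\<lambda>x. 1 / tau t j * U j x + (- 1 / tau t j) * U (j - 1) x) \<in> H10 \<Omega>"
      using that by (intro H10_lincomb[OF \<Omega>] UH) auto
    then show ?thesis by (simp add: \<delta>_def diff_quot_def diff_divide_distrib)
  qed
  have negH: "(\<lambda>x. - v x) \<in> H10 \<Omega>" if "v \<in> H10 \<Omega>" for v
    using H10_lincomb[OF \<Omega> that that, of "- 1" 0] by simp
  have \<tau>: "simple_H10 \<Omega> \<tau>"
    using \<delta>H negH by (auto simp: simple_H10_def \<tau>_def I_def)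
  have "W11_H10 \<Omega> T w w'"
    unfolding w_def w'_def using M by (intro W11_H10_add_simple[OF \<Omega> u \<tau>] negH UH) auto
  then have repr: "AE x in lebesgue_on \<Omega>.
      integrable (lebesgue_on {0<..<T}) (\<lambda>s. parabolic_op \<Omega> L w w' s (G x (T - s))) \<and>
      w T x = pairing \<Omega> (G x T) (w 0) +
        (LINT s|lebesgue_on {0<..<T}. parabolic_op \<Omega> L w w' s (G x (T - s)))"
    using assms(7) T unfolding greens_representation_def by auto

  have integral: "simple_integral_on 0 s \<tau> x
      = - (\<Sum>j=1..M. measure lborel (I j \<inter> {0..s}) * \<delta> j x)" for s x
    by (simp add: simple_integral_on_def \<tau>_def o_def interv_sum_list_conv_sum_set_nat
        atLeastLessThanSuc_atLeastAtMost sum_negf del: upt_Suc)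
  have w_cell: "w s x = u s x - U i x + (t i - s) * \<delta> i x"
    if "i \<in> {1..M}" "t (i - 1) \<le> s" "s \<le> t i" for i s x
    using piecewise_linear_interpolant[OF mesh that, of "\<lambda>j. U j x"]
    by (simp add: w_def integral I_def \<delta>_def diff_quot_def)
  have tM: "t M = T" and t0: "t 0 = 0" using mesh by (simp_all add: mesh_def)
  have wT: "w T x = u T x - U M x" for x
    using w_cell[of M T x] M mesh_bounds(2)[OF mesh, of M] tM by simp
  have w0: "w 0 x = u 0 x - U 0 x" for x
    using w_cell[of 1 0 x] M mesh_bounds(2)[OF mesh, of 1] t0
    by (simp add: \<delta>_def diff_quot_def tau_def)
  have w0_ae: "AE x in lebesgue_on \<Omega>. w 0 x = 0"
  proof -
    have "AE x in lebesgue_on \<Omega>. U 0 x = u0 x" using BE by blast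
    with u_init show ?thesis by eventually_elim (simp add: w0)
  qed
  have w'_cell: "w' s = (\<lambda>x. 1 * u' s x + (- 1) * \<delta> i x)" if "i \<in> {1..M}" "s \<in> I i" for i s
  proof
    fix x
    have disj: "s \<notin> I j" if "j \<in> {1..M}" "j \<noteq> i" for j
    proof (cases "j < i")
      case True
      then have "t j \<le> t (i - 1)" using \<open>i \<in> {1..M}\<close> by (intro mesh_mono[OF mesh]) auto
      then show ?thesis using \<open>s \<in> I i\<close> by (auto simp: I_def)
    next
      case False
      then have "t i \<le> t (j - 1)" using that by (intro mesh_mono[OF mesh]) auto
      then show ?thesis using \<open>s \<in> I i\<close> by (auto simp: I_def)
    qed
    have "simple_eval \<tau> s x = (\<Sum>j=1..M. indicat_real (I j) s * - \<delta> j x)"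
      by (simp add: simple_eval_def \<tau>_def o_def interv_sum_list_conv_sum_set_nat
          atLeastLessThanSuc_atLeastAtMost del: upt_Suc)
    also have "\<dots> = (\<Sum>j\<in>{1..M}. if j = i then - \<delta> i x else 0)"
      using disj that(2) by (intro sum.cong) auto
    finally show "w' s x = 1 * u' s x + (- 1) * \<delta> i x"
      using that(1) by (simp add: w'_def)
  qed

  have pointwise: "ennreal \<bar>w T x\<bar> \<le> ?estimate"
    if x: "x \<in> \<Omega>"
      and int: "integrable (lebesgue_on {0<..<T}) (\<lambda>s. parabolic_op \<Omega> L w w' s (G x (T - s)))"
      and wTx: "w T x = pairing \<Omega> (G x T) (w 0) +
        (LINT s|lebesgue_on {0<..<T}. parabolic_op \<Omega> L w w' s (G x (T - s)))" for x
  proof -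
    let ?P = "\<lambda>s. parabolic_op \<Omega> L w w' s (G x (T - s))"
    have g: "greens_function \<Omega> L x (G x)" and D: "time_derivatives \<Omega> (G x) (DG x)"
      using G DG x by auto
    have bound: "L1_norm \<Omega> (DG x p s) \<le> ennreal ((\<kappa> p / s ^ p + \<kappa>' p) * exp (- \<gamma> * s))"
      if "s \<in> {0<..<T}" "p \<le> 2" for p s using assms(12) x that by auto
    have bound0: "L1_norm \<Omega> (G x s) \<le> ennreal (\<kappa> 0 * exp (- \<gamma> * s))" if "s \<in> {0<..<T}" for s
      using bound[OF that, of 0] D assms(11) by (simp add: time_derivatives_def)
    have bound1: "L1_norm \<Omega> (DG x 1 s) \<le> ennreal ((\<kappa> 1 / s + \<kappa>' 1) * exp (- \<gamma> * s))"
      if "s \<in> {0<..<T}" for s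
      using bound[OF that, of 1] by simp
    have P_cell: "AE s in lebesgue_on (I j). ?P s = pairing \<Omega> (\<lambda>x. f s x - f (t j) x) (G x (T - s))
        + (t j - s) * L (\<delta> j) (G x (T - s))" if j: "j \<in> {1..M}" for j
    proof -
      note mb = mesh_bounds[OF mesh j]
      have sub: "I j \<subseteq> {0..T}" using mb by (auto simp: I_def)
      have transfer: "AE s in lebesgue_on (I j). Q s" if "AE s in lebesgue_on {0..T}. Q s" for Q
      proof -
        have "AE s in lebesgue. s \<in> {0..T} \<longrightarrow> Q s"
          using that by (subst (asm) AE_restrict_space_iff) auto
        then have "AE s in lebesgue. s \<in> I j \<longrightarrow> Q s"
          by eventually_elim (use sub in auto)
        then show ?thesis by (subst AE_restrict_space_iff) (auto simp: I_def)
      qed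
      show ?thesis
        using transfer[OF pde] transfer[OF u'H] AE_space
      proof eventually_elim
        case (elim s)
        then have s: "s \<in> I j" "s \<in> {0..T}" "T - s > 0" using sub mb by (auto simp: I_def)
        define h where "h = G x (T - s)"
        have h: "h \<in> H10 \<Omega>" unfolding h_def by (rule greens_functionD(1)[OF g s(3)])
        note L2 = H10_D(1)[OF \<Omega>]
        note lin = greens_function_op_lincomb[OF \<Omega> g s(3), folded h_def]
        have tj: "t j \<in> {0..T}" using mb by auto
        note cells = uH[OF s(2)] UH[of j] \<delta>H[OF j]
        have "w s = (\<lambda>x. 1 * (1 * u s x + (- 1) * U j x) + (t j - s) * \<delta> j x)"
          using w_cell[OF j, of s] s(1) by (auto simp: I_def)
        then have "L (w s) h = L (\<lambda>x. 1 * (1 * u s x + (- 1) * U j x) + (t j - s) * \<delta> j x) h"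
          by simp
        also have "\<dots> = 1 * L (\<lambda>x. 1 * u s x + (- 1) * U j x) h + (t j - s) * L (\<delta> j) h"
          using j cells by (intro lin H10_lincomb[OF \<Omega>]) auto
        also have "L (\<lambda>x. 1 * u s x + (- 1) * U j x) h = 1 * L (u s) h + (- 1) * L (U j) h"
          using j cells by (intro lin) auto
        finally have "L (w s) h = L (u s) h - L (U j) h + (t j - s) * L (\<delta> j) h" by simp
        moreover have "pairing \<Omega> (w' s) h = pairing \<Omega> (u' s) h - pairing \<Omega> (\<delta> j) h"
          unfolding w'_cell[OF j s(1)] pairing_lincomb_left[OF L2[OF elim(2)] L2[OF \<delta>H[OF j]] L2[OF h]]
          by simp
        moreover have "pairing \<Omega> (u' s) h + L (u s) h = pairing \<Omega> (f s) h"
          using elim(1) h by (auto simp: parabolic_op_def)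
        moreover have "pairing \<Omega> (\<delta> j) h + L (U j) h = pairing \<Omega> (f (t j)) h"
          using BE j h by (auto simp: \<delta>_def)
        moreover have "pairing \<Omega> (\<lambda>x. f s x - f (t j) x) h = pairing \<Omega> (f s) h - pairing \<Omega> (f (t j)) h"
          using pairing_lincomb_left[of "f s" \<Omega> "f (t j)" h 1 "- 1"] f s(2) tj L2[OF h] by simp
        ultimately show ?case by (simp add: parabolic_op_def h_def)
      qed
    qed
    have init: "pairing \<Omega> (G x T) (w 0) = 0"
      unfolding pairing_def by (rule integral_eq_zero_AE) (use w0_ae in eventually_elim, simp)
    have "ennreal \<bar>w T x\<bar> \<le> (\<integral>\<^sup>+s. ennreal \<bar>?P s\<bar> \<partial>lebesgue_on {0<..<T})"
      using integral_norm_bound_ennreal[OF int] wTx init by simp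
    also have "\<dots> \<le> (\<Sum>j=1..M. \<integral>\<^sup>+s. ennreal \<bar>?P s\<bar> \<partial>lebesgue_on {t (j - 1)<..<t j})"
      using int by (intro nn_integral_mesh_le[OF mesh]) auto
    also have "\<dots> \<le> ?estimate"
    proof (rule sum_mono)
      fix j assume j: "j \<in> {1..M}"
      have "{t (j - 1)<..<t j} \<subseteq> {0<..<T}" using mesh_bounds[OF mesh j] by auto
      from measurable_restrict_mono[OF borel_measurable_integrable[OF int] this]
      show "(\<integral>\<^sup>+s. ennreal \<bar>?P s\<bar> \<partial>lebesgue_on {t (j - 1)<..<t j})
        \<le> ennreal (exp (- \<gamma> * (T - t j))) *
            (eta_f \<Omega> (\<kappa> 0) f t j + eta_min \<Omega> T (\<kappa> 0) (\<kappa> 1) (\<kappa>' 1) L t U j)"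
        using assms(10) j P_cell[OF j, unfolded I_def \<delta>_def]
        by (intro cell_residual_estimate[OF \<Omega> g D \<open>\<gamma> \<ge> 0\<close> _ _ _ bound0 bound1 mesh j _ _ f] UH)
           auto
    qed
    finally show ?thesis .
  qed

  have "(\<lambda>x. u T x - U M x) \<in> borel_measurable (lebesgue_on \<Omega>)"
    using H10_D(1)[OF \<Omega> uH[of T]] H10_D(1)[OF \<Omega> UH[of M]] T by (auto simp: L2_def)
  then have "(\<lambda>x. ennreal \<bar>u T x - U M x\<bar>) \<in> borel_measurable (lebesgue_on \<Omega>)" by auto
  moreover have "AE x in lebesgue_on \<Omega>. ennreal \<bar>u T x - U M x\<bar> \<le> ?estimate"
    using repr AE_space
  proof eventually_elim
    case (elim x)
    then show ?case using pointwise[of x] by (simp add: wT)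
  qed
  ultimately show ?thesis unfolding Linf_norm_def by (rule esssup_I)
qed

end
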